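(* For the bilinear form $b(v,u)=\varepsilon\int_0^1 u'v'\,dx+\int_0^1 u'v\,dx$ considered with trial space $\mathcal{M}_h$ and bubble enriched test space $V_h$, the discrete optimal norm on $\mathcal{M}_h$, defined by $$\|u_h\|_{*,h}:=\sup_{0\ne v_h\in V_h}\frac{b(v_h,u_h)}{|v_h|},$$ is given, for all $u_h\in\mathcal{M}_h$, by $$\|u_h\|_{*,h}^2=\frac{(\varepsilon+h\,b_1)^2}{1+b_2}\,|u_h|^2+\frac{1}{1+b_2}\,|u_h|_{*,h}^2 .$$
   Context: Let $\varepsilon>0$, let $n\ge 2$ be an integer, $h=1/n$, and $x_j=jh$ for $j=0,\dots,n$. On $H_0^1(0,1)$ put $|u|^2=\int_0^1 (u'(x))^2\,dx$. Trial space: $\mathcal{M}_h=\mathrm{span}\{\varphi_j\}_{j=1}^{n-1}$ is the space of continuous functions on $[0,1]$ that are linear on each $[x_{j-1},x_j]$ and vanish at $0$ and $1$; $\varphi_j$ are the nodal basis functions, $\varphi_j(x_i)=\delta_{ij}$. Bubble functions: let $B:[0,h]\to\mathbb{R}$ be a continuous function (with weak derivative $B'\in L^2(0,h)$) such that $B(0)=B(h)=0$, $\int_0^h B(x)\,dx=b_1h$ with $b_1>0$, and $\int_0^h (B'(x))^2\,dx=b_2/h$ with $b_2>0$. For $i=1,\dots,n$ let $B_i(x)=B(x-x_{i-1})$ on $[x_{i-1},x_i]$ and $B_i=0$ on the rest of $[0,1]$. Test space: $V_h=\mathrm{span}\{\varphi_j+(B_j-B_{j+1})\}_{j=1}^{n-1}\subset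 H_0^1(0,1)$. The seminorm $|\cdot|_{*,h}$ is defined by $$|u|_{*,h}^2:=\frac1n\sum_{i=1}^n\left(\frac1h\int_{x_{i-1}}^{x_i}u(x)\,dx\right)^2-\left(\int_0^1u(x)\,dx\right)^2 .$$ *)

theory Defs
  imports "HOL-Analysis.Analysis"
begin

section \<open>Weak derivatives and the energy norm\<close>

definition test_function :: "real \<Rightarrow> real \<Rightarrow> (real \<Rightarrow> real) \<Rightarrow> bool" where
  "test_function a b \<phi> \<longleftrightarrow>
     (\<forall>k. (deriv ^^ k) \<phi> differentiable_on UNIV) \<and>
     (\<exists>c d. a < c \<and> d < b \<and> (\<forall>x. x \<notin> {c..d} \<longrightarrow> \<phi> x = 0))"

definition locally_integrable :: "real \<Rightarrow> real \<Rightarrow> (real \<Rightarrow> real) \<Rightarrow> bool" where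
  "locally_integrable a b f \<longleftrightarrow> (\<forall>c d. a < c \<longrightarrow> d < b \<longrightarrow> set_integrable lebesgue {c..d} f)"

definition has_weak_derivative :: "real \<Rightarrow> real \<Rightarrow> (real \<Rightarrow> real) \<Rightarrow> (real \<Rightarrow> real) \<Rightarrow> bool" where
  "has_weak_derivative a b f g \<longleftrightarrow>
     locally_integrable a b f \<and> locally_integrable a b g \<and>
     (\<forall>\<phi>. test_function a b \<phi> \<longrightarrow>
        (LINT x:{a<..<b}|lebesgue. f x * deriv \<phi> x) = - (LINT x:{a<..<b}|lebesgue. g x * \<phi> x))"

text \<open>
  Some representative of the weak derivative, which is unique up to a null set. It is only used
  under integrals. If \<open>f\<close> is not weakly differentiable on \<open>(a, b)\<close>, the value is
  arbitrary.
\<close>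
definition weak_deriv :: "real \<Rightarrow> real \<Rightarrow> (real \<Rightarrow> real) \<Rightarrow> real \<Rightarrow> real" where
  "weak_deriv a b f = (SOME g. has_weak_derivative a b f g)"

definition square_integrable_on :: "(real \<Rightarrow> real) \<Rightarrow> real set \<Rightarrow> bool" where
  "square_integrable_on f S \<longleftrightarrow>
     set_borel_measurable lebesgue S f \<and> set_integrable lebesgue S (\<lambda>x. (f x)\<^sup>2)"

definition energy_norm :: "(real \<Rightarrow> real) \<Rightarrow> real" where
  "energy_norm u = sqrt (LINT x:{0..1}|lebesgue. (weak_deriv 0 1 u x)\<^sup>2)"

definition bform :: "real \<Rightarrow> (real \<Rightarrow> real) \<Rightarrow> (real \<Rightarrow> real) \<Rightarrow> real" where
  "bform \<epsilon> v u =
     \<epsilon> * (LINT x:{0..1}|lebesgue. weak_deriv 0 1 u x * weak_deriv 0 1 v x) +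
     (LINT x:{0..1}|lebesgue. weak_deriv 0 1 u x * v x)"


section \<open>Discrete spaces\<close>

text \<open>
  A function on \<open>[0, 1]\<close> is represented by its extension by zero to the real line, so that
  \<open>v = 0\<close> means that \<open>v\<close> vanishes on \<open>[0, 1]\<close>.
\<close>

definition mesh_size :: "nat \<Rightarrow> real" where
  "mesh_size n = 1 / real n"

definition node :: "nat \<Rightarrow> nat \<Rightarrow> real" where
  "node n j = real j * mesh_size n"

definition trial_space :: "nat \<Rightarrow> (real \<Rightarrow> real) set" where
  "trial_space n = {u. continuous_on {0..1} u \<and>
     (\<forall>j\<in>{1..n}. \<exists>p q. \<forall>x\<in>{node n (j - 1)..node n j}. u x = p + q * x) \<and>
     u 0 = 0 \<and> u 1 = 0 \<and> (\<forall>x. x \<notin> {0..1} \<longrightarrow> u x = 0)}"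

definition hat :: "nat \<Rightarrow> nat \<Rightarrow> real \<Rightarrow> real" where
  "hat n j x = max 0 (1 - \<bar>x - node n j\<bar> / mesh_size n)"

definition bubble :: "nat \<Rightarrow> (real \<Rightarrow> real) \<Rightarrow> nat \<Rightarrow> real \<Rightarrow> real" where
  "bubble n B i x =
     (if x \<in> {node n (i - 1)..node n i} then B (x - node n (i - 1)) else 0)"

definition test_space :: "nat \<Rightarrow> (real \<Rightarrow> real) \<Rightarrow> (real \<Rightarrow> real) set" where
  "test_space n B =
     {v. \<exists>c :: nat \<Rightarrow> real.
        v = (\<lambda>x. \<Sum>j = 1..n - 1. c j * (hat n j x + (bubble n B j x - bubble n B (j + 1) x)))}"

definition star_seminorm :: "nat \<Rightarrow> (real \<Rightarrow> real) \<Rightarrow> real" where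
  "star_seminorm n u =
     sqrt (1 / real n *
             (\<Sum>i = 1..n. (1 / mesh_size n *
                (LINT x:{node n (i - 1)..node n i}|lebesgue. u x))\<^sup>2) -
           (LINT x:{0..1}|lebesgue. u x)\<^sup>2)"

text \<open>
  The supremum is taken in the extended reals: the real \<^term>\<open>Sup\<close> of an unbounded set
  would be unspecified.
\<close>
definition discrete_optimal_norm ::
    "real \<Rightarrow> nat \<Rightarrow> (real \<Rightarrow> real) \<Rightarrow> (real \<Rightarrow> real) \<Rightarrow> ereal" where
  "discrete_optimal_norm \<epsilon> n B u =
     (SUP v \<in> test_space n B - {\<lambda>x. 0}. ereal (bform \<epsilon> v u / energy_norm v))"


section \<open>The hat functions are the nodal basis of the trial space\<close>

lemma hat_eq: "n > 0 \<Longrightarrow> hat n j x = max 0 (1 - \<bar>real n * x - real j\<bar>)"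
proof -
  assume n: "n > 0"
  have "\<bar>real n * x - real j\<bar> = real n * \<bar>x - real j / real n\<bar>"
  proof -
    have "real n * x - real j = real n * (x - real j / real n)"
      using n by (simp add: field_simps)
    then show ?thesis by (simp only: abs_mult abs_of_nat)
  qed
  then show ?thesis
    by (simp add: hat_def node_def mesh_size_def mult.commute)
qed

lemma hat_node: "n > 0 \<Longrightarrow> hat n j (node n i) = (if i = j then 1 else 0)"
proof -
  assume n: "n > 0"
  have "real n * node n i = real i"
    using n by (simp add: node_def mesh_size_def)
  then show ?thesis
    using n by (auto simp: hat_eq)
qed

lemma hat_affine:
  assumes n: "n > 0" and i: "i \<in> {1..n}"
  shows "\<exists>p q. \<forall>x\<in>{node n (i - 1)..node n i}. hat n j x = p + q * x"
proof -
  have bd: "real i - 1 \<le> real n * x \<and> real n * x \<le> real i"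
    if "x \<in> {node n (i - 1)..node n i}" for x
    using that n i by (auto simp: node_def mesh_size_def of_nat_diff field_simps)
  consider "i = j" | "i = j + 1" | "i < j" | "i > j + 1" by linarith
  then show ?thesis
  proof cases
    case 1
    have "\<forall>x\<in>{node n (i - 1)..node n i}. hat n j x = (1 - real j) + real n * x"
    proof
      fix x assume "x \<in> {node n (i - 1)..node n i}"
      from bd[OF this] 1 show "hat n j x = (1 - real j) + real n * x"
        unfolding hat_eq[OF n] by (auto simp: max_def abs_if algebra_simps)
    qed
    then show ?thesis by blast
  next
    case 2
    have "\<forall>x\<in>{node n (i - 1)..node n i}. hat n j x = (1 + real j) + (- real n) * x"
    proof
      fix x assume "x \<in> {node n (i - 1)..node n i}"
      from bd[OF this] 2 show "hat n j x = (1 + real j) + (- real n) * x"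
        unfolding hat_eq[OF n] by (auto simp: max_def abs_if algebra_simps)
    qed
    then show ?thesis by blast
  next
    case 3
    then have j: "real i \<le> real j - 1" by linarith
    have "\<forall>x\<in>{node n (i - 1)..node n i}. hat n j x = 0 + 0 * x"
    proof
      fix x assume "x \<in> {node n (i - 1)..node n i}"
      from bd[OF this] j show "hat n j x = 0 + 0 * x"
        unfolding hat_eq[OF n] by (auto simp: max_def abs_if algebra_simps)
    qed
    then show ?thesis by blast
  next
    case 4
    then have j: "real i \<ge> real j + 2" by linarith
    have "\<forall>x\<in>{node n (i - 1)..node n i}. hat n j x = 0 + 0 * x"
    proof
      fix x assume "x \<in> {node n (i - 1)..node n i}"
      from bd[OF this] j show "hat n j x = 0 + 0 * x"
        unfolding hat_eq[OF n] by (auto simp: max_def abs_if algebra_simps)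
    qed
    then show ?thesis by blast
  qed
qed

lemma hat_outside:
  assumes n: "n > 0" and j: "j \<in> {1..n - 1}" and x: "x \<le> 0 \<or> x \<ge> 1"
  shows "hat n j x = 0"
proof -
  from j n have j': "1 \<le> real j" "real j \<le> real n - 1" by auto
  from x have "real n * x \<le> 0 \<or> real n * x \<ge> real n"
    using n by (auto simp: mult_le_0_iff)
  with j' have "\<bar>real n * x - real j\<bar> \<ge> 1" by linarith
  then show ?thesis using n by (simp add: hat_eq)
qed

lemma sum_hat_affine:
  assumes n: "n > 0" and i: "i \<in> {1..n}"
  shows "\<exists>p q. \<forall>x\<in>{node n (i - 1)..node n i}. (\<Sum>j\<in>J. c j * hat n j x) = p + q * x"
proof -
  from hat_affine[OF n i]
  obtain p q where pq: "\<And>j x. x \<in> {node n (i - 1)..node n i} \<Longrightarrow> hat n j x = p j + q j * x"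
    by metis
  have "(\<Sum>j\<in>J. c j * hat n j x) = (\<Sum>j\<in>J. c j * p j) + (\<Sum>j\<in>J. c j * q j) * x"
    if "x \<in> {node n (i - 1)..node n i}" for x
    by (simp add: pq[OF that] distrib_left sum.distrib sum_distrib_right mult.assoc)
  then show ?thesis by blast
qed

lemma unit_interval_cell:
  assumes n: "n > 0" and x: "x \<in> {0..1}"
  obtains i where "i \<in> {1..n}" "x \<in> {node n (i - 1)..node n i}"
proof (cases "x = 0")
  case True
  then show ?thesis using n that[of 1] by (simp add: node_def mesh_size_def)
next
  case False
  define i where "i = nat \<lceil>real n * x\<rceil>"
  have pos: "real n * x > 0" using n x False by simp
  have le: "real n * x \<le> real n" using n x by (simp add: mult_left_le)
  have 1: "real n * x \<le> real i" "real i < real n * x + 1" using pos unfolding i_def by linarith+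
  have i: "i \<in> {1..n}" using 1 pos le by auto
  have "x \<in> {node n (i - 1)..node n i}"
    using 1 i n by (auto simp: node_def mesh_size_def of_nat_diff field_simps)
  with i show ?thesis by (rule that)
qed

lemma affine_eq_of_two_points:
  fixes a b x :: real
  assumes "a < b" "\<forall>x\<in>{a..b}. f x = p + q * x" "\<forall>x\<in>{a..b}. g x = p' + q' * x"
    and "f a = g a" "f b = g b" and x: "x \<in> {a..b}"
  shows "f x = g x"
proof -
  have 1: "p + q * a = p' + q' * a" and 2: "p + q * b = p' + q' * b" using assms by auto
  then have "(q - q') * (b - a) = 0" by (simp add: algebra_simps)
  then have "q = q'" using assms by simp
  with 1 have "p = p'" by simp
  show ?thesis using assms \<open>p = p'\<close> \<open>q = q'\<close> by simp
qed

lemma trial_space_eq_span_hat: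
  assumes n: "n > 0"
  shows "trial_space n = {u. \<exists>c. u = (\<lambda>x. \<Sum>j = 1..n - 1. c j * hat n j x)}" (is "_ = ?S")
proof (intro equalityI subsetI)
  fix u assume "u \<in> ?S"
  then obtain c where u: "u = (\<lambda>x. \<Sum>j = 1..n - 1. c j * hat n j x)" by blast
  have "\<forall>i\<in>{1..n}. \<exists>p q. \<forall>x\<in>{node n (i - 1)..node n i}. u x = p + q * x"
    unfolding u using sum_hat_affine[OF n] by blast
  moreover have "u x = 0" if "x \<le> 0 \<or> x \<ge> 1" for x
    unfolding u using hat_outside[OF n] that by (intro sum.neutral) auto
  moreover have "continuous_on {0..1} u"
    unfolding u hat_def divide_inverse by (intro continuous_intros)
  ultimately show "u \<in> trial_space n"
    by (auto simp: trial_space_def)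
next
  fix u assume u: "u \<in> trial_space n"
  define w where "w = (\<lambda>x. \<Sum>j = 1..n - 1. u (node n j) * hat n j x)"
  have node_in: "node n 0 = 0" "node n n = 1"
    using n by (auto simp: node_def mesh_size_def)
  have w_node: "w (node n i) = u (node n i)" if "i \<le> n" for i
  proof -
    have "w (node n i) = (\<Sum>j = 1..n - 1. if i = j then u (node n j) else 0)"
      unfolding w_def by (intro sum.cong) (auto simp: hat_node n)
    also have "\<dots> = (if i \<in> {1..n - 1} then u (node n i) else 0)" by simp
    also have "\<dots> = u (node n i)"
    proof (cases "i \<in> {1..n - 1}")
      case False
      then have "i = 0 \<or> i = n" using that by auto
      then show ?thesis using False node_in u by (auto simp: trial_space_def)
    qed simp
    finally show ?thesis .
  qed
  have "u x = w x" for x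
  proof (cases "x \<in> {0..1}")
    case True
    then obtain i where i: "i \<in> {1..n}" and x: "x \<in> {node n (i - 1)..node n i}"
      using unit_interval_cell[OF n] by blast
    from u i obtain p q where 1: "\<forall>x\<in>{node n (i - 1)..node n i}. u x = p + q * x"
      unfolding trial_space_def by blast
    from sum_hat_affine[OF n i, where J = "{1..n - 1}" and c = "\<lambda>j. u (node n j)"]
    obtain p' q'
      where 2: "\<forall>x\<in>{node n (i - 1)..node n i}. w x = p' + q' * x"
      unfolding w_def by blast
    have "node n (i - 1) < node n i"
      using n i by (auto simp: node_def mesh_size_def of_nat_diff divide_strict_right_mono)
    then show ?thesis
      by (rule affine_eq_of_two_points[OF _ 1 2 _ _ x]) (use w_node i in auto)
  next
    case False
    then have "x \<le> 0 \<or> x \<ge> 1" by auto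
    then have "w x = 0" unfolding w_def
      using hat_outside[OF n] by (intro sum.neutral) auto
    then show ?thesis using u False unfolding trial_space_def by auto
  qed
  then have "u = w" by blast
  then show "u \<in> ?S" unfolding w_def by (intro CollectI exI)
qed

end

theory Submission
  imports Defs
begin

text \<open>
  On the cell \<open>[x\<^sub>i\<^sub>-\<^sub>1, x\<^sub>i]\<close> a function of the test space with nodal values \<open>c\<close> has the derivative
  \<open>d\<^sub>i (1/h + B')\<close>, where \<open>d\<^sub>i = c\<^sub>i - c\<^sub>i\<^sub>-\<^sub>1\<close>: a hat function plus its two bubbles is the difference of two
  consecutive translates of a single ramp, which rises from \<open>0\<close> to \<open>1\<close> along \<open>x/h + B(x)\<close>.
  Since \<open>B'\<close> has integral \<open>0\<close> over the cell, the energy of a test function is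
  \<open>(1 + b\<^sub>2)/h\<close> times the sum of the \<open>d\<^sub>i\<^sup>2\<close>. The functions of the trial space are the case \<open>B = 0\<close>.
  
  Let \<open>u\<close> have nodal values \<open>a\<close>, increments \<open>e\<^sub>i\<close> and cell averages
  \<open>m\<^sub>i = (a\<^sub>i + a\<^sub>i\<^sub>-\<^sub>1)/2\<close>. Integration over the cells and summation by parts give
  \<open>b(v, u) = \<Sum>\<^sub>i d\<^sub>i (\<kappa> e\<^sub>i - m\<^sub>i)\<close> with \<open>\<kappa> = (\<epsilon> + h b\<^sub>1)/h\<close>. The admissible \<open>d\<close> are exactly the
  vectors with sum \<open>0\<close>, so \<open>m\<close> may be replaced by its deviation from its mean, and by the
  Cauchy-Schwarz inequality the supremum is \<open>sqrt (h/(1 + b\<^sub>2))\<close> times the Euclidean norm of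
  \<open>\<kappa> e - (m - mean m)\<close>. It is attained because this vector itself has sum \<open>0\<close>. The two parts are
  orthogonal, as \<open>\<Sum>\<^sub>i e\<^sub>i m\<^sub>i\<close> telescopes to \<open>0\<close>; the first contributes the energy norm of \<open>u\<close> and the second
  the seminorm, which is the variance of the cell averages.
  
  The analytic part justifies these computations for weak derivatives. The operator \<open>weak_deriv\<close>
  returns an unspecified representative, so its uniqueness almost everywhere is needed
  (\<open>has_weak_derivative_unique\<close>); it rests on smooth cutoff functions that converge boundedly to the
  indicator of an interval. That the bubbles, extended by \<open>0\<close>, remain weakly differentiable across the nodes
  is the content of \<open>integration_by_parts_weak_derivative\<close>: test functions on the unit interval do
  not vanish at the nodes, but \<open>B\<close> does.
\<close>

section \<open>Smooth functions and cutoffs\<close>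

text \<open>
  Smoothness is stated through iterated derivatives, but a closure property of such a notion is not
  inductive: the derivative of a product is not a product. The predicate \<open>ndiff\<close> peels off one derivative
  at a time, so that closure under sums and products can be proved by induction on the order.
\<close>
primrec ndiff :: "nat \<Rightarrow> (real \<Rightarrow> real) \<Rightarrow> bool" where
  "ndiff 0 f \<longleftrightarrow> True"
| "ndiff (Suc n) f \<longleftrightarrow> (\<exists>f'. (\<forall>x. (f has_real_derivative f' x) (at x)) \<and> ndiff n f')"

definition smooth :: "(real \<Rightarrow> real) \<Rightarrow> bool" where
  "smooth f \<longleftrightarrow> (\<forall>k. (deriv ^^ k) f differentiable_on UNIV)"

lemma ndiff_Suc_imp: "ndiff (Suc n) f \<Longrightarrow> ndiff n f"
  by (induction n arbitrary: f) auto

lemma ndiff_add: "ndiff n f \<Longrightarrow> ndiff n g \<Longrightarrow> ndiff n (\<lambda>x. f x + g x)"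
proof (induction n arbitrary: f g)
  case (Suc n)
  then obtain f' g' where *: "\<forall>x. (f has_real_derivative f' x) (at x)" "ndiff n f'"
    "\<forall>x. (g has_real_derivative g' x) (at x)" "ndiff n g'" by auto
  then have "ndiff n (\<lambda>x. f' x + g' x)" using Suc.IH by blast
  then show ?case using * by (auto intro!: exI[of _ "\<lambda>x. f' x + g' x"] DERIV_add)
qed simp

lemma ndiff_const: "ndiff n (\<lambda>x. c)"
  by (induction n arbitrary: c) (auto intro!: exI[of _ "\<lambda>x. 0"])

text \<open>
  The induction hypothesis applies to the two products in the Leibniz rule because
  \<open>n + 1\<close> times differentiable functions are in particular \<open>n\<close> times differentiable.
\<close>
lemma ndiff_mult: "ndiff n f \<Longrightarrow> ndiff n g \<Longrightarrow> ndiff n (\<lambda>x. f x * g x)"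
proof (induction n arbitrary: f g)
  case (Suc n)
  then obtain f' g' where *: "\<forall>x. (f has_real_derivative f' x) (at x)" "ndiff n f'"
    "\<forall>x. (g has_real_derivative g' x) (at x)" "ndiff n g'" by auto
  have "ndiff n f" "ndiff n g" using Suc.prems ndiff_Suc_imp by blast+
  then have "ndiff n (\<lambda>x. f' x * g x + g' x * f x)"
    using * Suc.IH by (intro ndiff_add) auto
  then show ?case
    using * by (auto intro!: exI[of _ "\<lambda>x. f' x * g x + g' x * f x"] DERIV_mult)
qed simp

lemma ndiff_affine: "ndiff n f \<Longrightarrow> ndiff n (\<lambda>x. f (p + q * x))"
proof (induction n arbitrary: f)
  case (Suc n)
  then obtain f' where f': "\<forall>x. (f has_real_derivative f' x) (at x)" "ndiff n f'" by auto
  then have "ndiff n (\<lambda>x. f' (p + q * x) * q)"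
    using Suc.IH by (intro ndiff_mult ndiff_const) auto
  moreover have "((\<lambda>x. f (p + q * x)) has_real_derivative f' (p + q * x) * q) (at x)" for x
    by (rule DERIV_chain2[of f]) (use f' in \<open>auto intro!: derivative_eq_intros\<close>)
  ultimately show ?case
    unfolding ndiff.simps by (intro exI[of _ "\<lambda>x. f' (p + q * x) * q"] conjI allI)
qed simp

lemma smooth_iff_ndiff: "smooth f \<longleftrightarrow> (\<forall>n. ndiff n f)"
proof
  assume "smooth f"
  have "\<forall>k. (deriv ^^ k) f differentiable_on UNIV \<Longrightarrow> ndiff n f" for n
  proof (induction n arbitrary: f)
    case (Suc n)
    from Suc.prems[rule_format, of 0] have "(f has_real_derivative deriv f x) (at x)" for x
      by (simp add: differentiable_on_def DERIV_deriv_iff_real_differentiable)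
    moreover have "ndiff n (deriv f)"
      by (rule Suc.IH) (metis Suc.prems funpow_Suc_right o_apply)
    ultimately show ?case by auto
  qed simp
  then show "\<forall>n. ndiff n f" using \<open>smooth f\<close> by (simp add: smooth_def)
next
  assume "\<forall>n. ndiff n f"
  have "ndiff (Suc k) f \<Longrightarrow> (deriv ^^ k) f differentiable_on UNIV" for k
  proof (induction k arbitrary: f)
    case 0
    then show ?case
      by (auto simp: differentiable_on_def real_differentiable_def)
  next
    case (Suc k)
    then obtain f' where f': "\<forall>x. (f has_real_derivative f' x) (at x)" "ndiff (Suc k) f'" by auto
    then have "deriv f = f'" by (auto intro!: DERIV_imp_deriv)
    then show ?case using Suc.IH[OF f'(2)] by (simp add: funpow_Suc_right del: funpow.simps)
  qed
  then show "smooth f" using \<open>\<forall>n. ndiff n f\<close> unfolding smooth_def by blast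
qed

lemma smooth_DERIV: "smooth f \<Longrightarrow> (f has_real_derivative deriv f x) (at x)"
  unfolding smooth_def
  by (metis DERIV_deriv_iff_real_differentiable UNIV_I differentiable_on_def funpow_0)

lemma smooth_deriv: "smooth f \<Longrightarrow> smooth (deriv f)"
  unfolding smooth_def by (metis funpow_Suc_right o_apply)

lemma smooth_continuous_on: "smooth f \<Longrightarrow> continuous_on S f"
  by (meson DERIV_isCont continuous_at_imp_continuous_on smooth_DERIV)

lemma smooth_const: "smooth (\<lambda>x. c)"
  by (simp add: smooth_iff_ndiff ndiff_const)

lemma smooth_mult: "smooth f \<Longrightarrow> smooth g \<Longrightarrow> smooth (\<lambda>x. f x * g x)"
  by (simp add: smooth_iff_ndiff ndiff_mult)

lemma smooth_affine: "smooth f \<Longrightarrow> smooth (\<lambda>x. f (p + q * x))"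
  by (simp add: smooth_iff_ndiff ndiff_affine)

text \<open>
  The classical function \<open>exp(-1/x)\<close> that is flat at \<open>0\<close>, multiplied by a power of \<open>1/x\<close>; with
  this factor the family spans a space that is closed under differentiation.
\<close>
definition flat_exp :: "nat \<Rightarrow> real \<Rightarrow> real" where
  "flat_exp k x = (if x > 0 then (1 / x) ^ k * exp (- (1 / x)) else 0)"

lemma flat_exp_tendsto_0: "(flat_exp k \<longlongrightarrow> 0) (at 0)"
proof -
  have "((\<lambda>x. inverse x ^ k / exp (inverse x)) \<longlongrightarrow> (0::real)) (at_right 0)"
    by (rule filterlim_compose[OF tendsto_power_div_exp_0 filterlim_inverse_at_top_right])
  then have "(flat_exp k \<longlongrightarrow> 0) (at_right 0)"
    by (rule Lim_transform_eventually)
      (auto simp: eventually_at_filter flat_exp_def exp_minus inverse_eq_divide)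
  moreover have "(flat_exp k \<longlongrightarrow> 0) (at_left 0)"
    by (rule Lim_transform_eventually[OF tendsto_const])
      (auto simp: eventually_at_filter flat_exp_def)
  ultimately show ?thesis by (simp add: filterlim_split_at)
qed

text \<open>
  At \<open>0\<close> the difference quotient of \<open>flat_exp k\<close> is \<open>flat_exp (k + 1)\<close>, which tends to \<open>0\<close>
  because the exponential beats every power.
\<close>
lemma DERIV_flat_exp:
  "(flat_exp k has_real_derivative flat_exp (k + 2) x + (- real k) * flat_exp (k + 1) x) (at x)"
proof -
  consider "x > 0" | "x < 0" | "x = 0" by linarith
  then show ?thesis
  proof cases
    case 1
    have "((\<lambda>x. (1 / x) ^ k * exp (- (1 / x))) has_real_derivative
        flat_exp (k + 2) x + (- real k) * flat_exp (k + 1) x) (at x)"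
    proof -
      have inv: "((\<lambda>x. 1 / x) has_real_derivative - ((1 / x) ^ 2)) (at x)"
        using 1 by (auto intro!: derivative_eq_intros simp: power2_eq_square)
      have "((\<lambda>x. (1 / x) ^ k * exp (- (1 / x))) has_real_derivative
          real k * (1 / x) ^ (k - 1) * (- ((1 / x) ^ 2)) * exp (- (1 / x))
            + exp (- (1 / x)) * (1 / x) ^ 2 * (1 / x) ^ k) (at x)"
        by (rule derivative_eq_intros inv refl | simp)+
      moreover have "real k * y ^ (k - 1) * (- (y ^ 2)) * z + z * y ^ 2 * y ^ k
          = y ^ (k + 2) * z + (- real k) * (y ^ (k + 1) * z)" for y z :: real
        by (cases k) (simp_all add: algebra_simps power2_eq_square)
      ultimately show ?thesis using 1 by (simp only: flat_exp_def if_True)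
    qed
    then show ?thesis
      by (rule has_field_derivative_transform_within_open[of _ _ _ "{0<..}"]) 
        (use 1 in \<open>auto simp: flat_exp_def\<close>)
  next
    case 2
    have "((\<lambda>x. 0) has_real_derivative
        flat_exp (k + 2) x + (- real k) * flat_exp (k + 1) x) (at x)"
      using 2 by (simp add: flat_exp_def)
    then show ?thesis
      by (rule has_field_derivative_transform_within_open[of _ _ _ "{..<0}"]) 
        (use 2 in \<open>auto simp: flat_exp_def\<close>)
  next
    case 3
    have "((\<lambda>x. (flat_exp k x - flat_exp k 0) / (x - 0)) \<longlongrightarrow> 0) (at 0)"
      by (rule Lim_transform_eventually[OF flat_exp_tendsto_0[of "Suc k"]])
        (auto simp: flat_exp_def eventually_at_filter)
    then show ?thesis using 3 by (simp add: has_field_derivative_iff flat_exp_def)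
  qed
qed

lemma smooth_flat_exp: "smooth (flat_exp k)"
proof -
  have "ndiff n (flat_exp k)" for n
  proof (induction n arbitrary: k)
    case (Suc n)
    have "ndiff n (\<lambda>x. flat_exp (k + 2) x + (- real k) * flat_exp (k + 1) x)"
      by (intro ndiff_add ndiff_mult ndiff_const Suc.IH)
    then show ?case
      unfolding ndiff.simps by (intro exI[of _ "\<lambda>x. flat_exp (k + 2) x + (- real k) * flat_exp (k + 1) x"]
          conjI allI DERIV_flat_exp)
  qed simp
  then show ?thesis by (simp add: smooth_iff_ndiff)
qed

text \<open>
  The shift by \<open>1\<close> moves the support to \<open>[a + 1/(m + 1), b - 1/(m + 1)]\<close>, strictly inside \<open>(a, b)\<close>,
  and the factor \<open>m + 1\<close> makes the functions converge to \<open>1\<close> there as \<open>m\<close> grows.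
\<close>
definition cutoff :: "real \<Rightarrow> real \<Rightarrow> nat \<Rightarrow> real \<Rightarrow> real" where
  "cutoff a b m x = flat_exp 0 (real (Suc m) * (x - a) - 1) * flat_exp 0 (real (Suc m) * (b - x) - 1)"

lemma flat_exp_nonneg: "flat_exp k x \<ge> 0"
  by (simp add: flat_exp_def)

lemma flat_exp_0_le_1: "flat_exp 0 x \<le> 1"
  by (simp add: flat_exp_def)

lemma flat_exp_0_tendsto_1: "(flat_exp 0 \<longlongrightarrow> 1) at_top"
proof -
  have "((\<lambda>x. exp (- inverse x)) \<longlongrightarrow> exp (- (0::real))) at_top"
    by (intro tendsto_intros tendsto_inverse_0_at_top filterlim_ident)
  then have "((\<lambda>x. exp (- inverse x)) \<longlongrightarrow> (1::real)) at_top" by simp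
  moreover have "eventually (\<lambda>x. exp (- inverse x) = flat_exp 0 x) at_top"
    using eventually_gt_at_top[of "0::real"]
    by eventually_elim (simp add: flat_exp_def inverse_eq_divide)
  ultimately show ?thesis by (rule Lim_transform_eventually)
qed

lemma rescaled_flat_exp_tendsto_1:
  assumes "t > 0"
  shows "(\<lambda>m. flat_exp 0 (real (Suc m) * t - 1)) \<longlonglongrightarrow> 1"
proof -
  have "filterlim (\<lambda>m. real (Suc m) * t - 1) at_top sequentially"
  proof -
    have "filterlim (\<lambda>m. (- 1) + t * real (Suc m)) at_top sequentially"
      using assms
      by (intro filterlim_tendsto_add_at_top[OF tendsto_const] filterlim_tendsto_pos_mult_at_top[OF tendsto_const]
          filterlim_compose[OF filterlim_real_sequentially filterlim_Suc])
    then show ?thesis by (simp add: mult.commute)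
  qed
  from filterlim_compose[OF flat_exp_0_tendsto_1 this] show ?thesis .
qed

lemma smooth_cutoff: "smooth (cutoff a b m)"
proof -
  have "smooth (\<lambda>x. flat_exp 0 ((- real (Suc m) * a - 1) + real (Suc m) * x) *
      flat_exp 0 ((real (Suc m) * b - 1) + (- real (Suc m)) * x))"
    by (intro smooth_mult smooth_affine smooth_flat_exp)
  also have "(\<lambda>x. flat_exp 0 ((- real (Suc m) * a - 1) + real (Suc m) * x) *
      flat_exp 0 ((real (Suc m) * b - 1) + (- real (Suc m)) * x)) = cutoff a b m"
    by (rule ext) (simp add: cutoff_def algebra_simps)
  finally show ?thesis .
qed

lemma cutoff_nonneg: "cutoff a b m x \<ge> 0"
  by (simp add: cutoff_def flat_exp_nonneg)

lemma cutoff_le_1: "cutoff a b m x \<le> 1"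
  unfolding cutoff_def by (intro mult_le_one flat_exp_nonneg flat_exp_0_le_1)

lemma cutoff_eq_0:
  assumes "x \<notin> {a + 1 / real (Suc m)..b - 1 / real (Suc m)}"
  shows "cutoff a b m x = 0"
proof -
  have "real (Suc m) * (x - a) - 1 \<le> 0 \<or> real (Suc m) * (b - x) - 1 \<le> 0"
    using assms by (auto simp: field_simps)
  then show ?thesis by (auto simp: cutoff_def flat_exp_def)
qed

lemma cutoff_tendsto_1:
  assumes "a < x" "x < b"
  shows "(\<lambda>m. cutoff a b m x) \<longlonglongrightarrow> 1"
  unfolding cutoff_def
  using tendsto_mult[OF rescaled_flat_exp_tendsto_1 rescaled_flat_exp_tendsto_1, of "x - a" "b - x"]
    assms by simp

lemma test_function_mult_cutoff:
  assumes "smooth \<phi>"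
  shows "test_function a b (\<lambda>x. \<phi> x * cutoff a b m x)"
proof -
  have "\<phi> x * cutoff a b m x = 0" if "x \<notin> {a + 1 / real (Suc m)..b - 1 / real (Suc m)}" for x
    using cutoff_eq_0[OF that] by simp
  moreover have "a < a + 1 / real (Suc m)" "b - 1 / real (Suc m) < b" by simp_all
  ultimately show ?thesis
    using smooth_mult[OF assms smooth_cutoff] unfolding test_function_def smooth_def by blast
qed

lemma test_function_smooth: "test_function a b \<phi> \<Longrightarrow> smooth \<phi>"
  by (simp add: test_function_def smooth_def)

lemma
  fixes f :: "real \<Rightarrow> real"
  shows set_integral_open_interval:
      "(LINT x:{a<..<b}|lebesgue. f x) = (LINT x:{a..b}|lebesgue. f x)"
    and set_integrable_open_interval:
      "set_integrable lebesgue {a<..<b} f \<longleftrightarrow> set_integrable lebesgue {a..b} f"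
  by (rule set_integral_discrete_difference[of "{a, b}"]
           set_integrable_discrete_difference[of "{a, b}"]; auto)+

lemma set_integrable_mult_bounded:
  fixes f \<phi> :: "real \<Rightarrow> real"
  assumes f: "set_integrable lebesgue S f" and \<phi>: "continuous_on UNIV \<phi>"
    and le: "\<And>x. x \<in> S \<Longrightarrow> \<bar>\<phi> x\<bar> \<le> C"
  shows "set_integrable lebesgue S (\<lambda>x. f x * \<phi> x)"
proof -
  have i: "integrable lebesgue (\<lambda>x. indicator S x *\<^sub>R f x)"
    using f by (simp add: set_integrable_def)
  have \<phi>m: "\<phi> \<in> borel_measurable lebesgue"
    using borel_measurable_continuous_onI[OF \<phi>] by (simp add: measurable_completion)
  have "integrable lebesgue (\<lambda>x. (indicator S x *\<^sub>R f x) * \<phi> x)"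
  proof (rule Bochner_Integration.integrable_bound)
    show "integrable lebesgue (\<lambda>x. C * (indicator S x *\<^sub>R f x))"
      using i by (rule integrable_mult_right)
    show "(\<lambda>x. (indicator S x *\<^sub>R f x) * \<phi> x) \<in> borel_measurable lebesgue"
      using borel_measurable_integrable[OF i] \<phi>m by (rule borel_measurable_times)
    have "\<bar>f x\<bar> * \<bar>\<phi> x\<bar> \<le> \<bar>C\<bar> * \<bar>f x\<bar>" if "x \<in> S" for x
      using mult_left_mono[of "\<bar>\<phi> x\<bar>" "\<bar>C\<bar>" "\<bar>f x\<bar>"] le[OF that] by (simp add: mult.commute)
    then show "AE x in lebesgue. norm ((indicator S x *\<^sub>R f x) * \<phi> x) \<le> norm (C * (indicator S x *\<^sub>R f x))"
      by (auto simp: indicator_def abs_mult)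
  qed
  then show ?thesis by (simp add: set_integrable_def mult.assoc)
qed

text \<open>
  Dominated convergence: the cutoffs are bounded by \<open>1\<close> and tend to \<open>1\<close> in the open interval.
\<close>
lemma set_integral_mult_cutoff_tendsto:
  fixes f :: "real \<Rightarrow> real"
  assumes f: "set_integrable lebesgue {a..b} f"
  shows "(\<lambda>m. LINT x:{a..b}|lebesgue. f x * cutoff a b m x) \<longlonglongrightarrow> (LINT x:{a..b}|lebesgue. f x)"
proof -
  have i: "integrable lebesgue (\<lambda>x. indicator {a<..<b} x *\<^sub>R f x)"
    using f[folded set_integrable_open_interval] by (simp add: set_integrable_def)
  have "set_integrable lebesgue {a<..<b} (\<lambda>x. f x * cutoff a b m x)" for m
    using f by (intro set_integrable_mult_bounded[where C = 1] smooth_continuous_on smooth_cutoff)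
      (auto simp: set_integrable_open_interval cutoff_nonneg cutoff_le_1)
  then have im: "integrable lebesgue (\<lambda>x. indicator {a<..<b} x *\<^sub>R (f x * cutoff a b m x))" for m
    by (simp add: set_integrable_def)
  have "(\<lambda>m. LINT x|lebesgue. indicator {a<..<b} x *\<^sub>R (f x * cutoff a b m x))
      \<longlonglongrightarrow> (LINT x|lebesgue. indicator {a<..<b} x *\<^sub>R f x)"
  proof (rule integral_dominated_convergence)
    show "(\<lambda>x. indicator {a<..<b} x *\<^sub>R f x) \<in> borel_measurable lebesgue"
      using i by (rule borel_measurable_integrable)
    show "(\<lambda>x. indicator {a<..<b} x *\<^sub>R (f x * cutoff a b m x)) \<in> borel_measurable lebesgue" for m
      using im by (rule borel_measurable_integrable)
    show "integrable lebesgue (\<lambda>x. norm (indicator {a<..<b} x *\<^sub>R f x))"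
      using i by (rule integrable_norm)
    show "AE x in lebesgue. (\<lambda>m. indicator {a<..<b} x *\<^sub>R (f x * cutoff a b m x))
        \<longlonglongrightarrow> indicator {a<..<b} x *\<^sub>R f x"
    proof (rule AE_I2)
      fix x :: real
      show "(\<lambda>m. indicator {a<..<b} x *\<^sub>R (f x * cutoff a b m x)) \<longlonglongrightarrow> indicator {a<..<b} x *\<^sub>R f x"
        using tendsto_mult[OF tendsto_const cutoff_tendsto_1, of a x b "f x"]
        by (cases "x \<in> {a<..<b}") (auto simp: indicator_def)
    qed
    show "AE x in lebesgue. norm (indicator {a<..<b} x *\<^sub>R (f x * cutoff a b m x))
        \<le> norm (indicator {a<..<b} x *\<^sub>R f x)" for m
      by (rule AE_I2) (auto simp: indicator_def abs_mult cutoff_nonneg cutoff_le_1 mult_left_le)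
  qed
  then show ?thesis
    by (simp only: set_lebesgue_integral_def[symmetric] set_integral_open_interval)
qed

section \<open>The fundamental lemma and uniqueness of weak derivatives\<close>

text \<open>
  The positive and the negative part of \<open>f\<close> are densities of two finite measures that agree on all rays
  and hence on all Borel sets; densities are unique almost everywhere. The argument takes place
  in the Borel \<open>\<sigma>\<close>-algebra, on which the rays are a generator, so \<open>f\<close> is first replaced by a Borel function.
\<close>
lemma AE_eq_0_if_ray_integrals_eq_0:
  fixes f :: "real \<Rightarrow> real"
  assumes f: "integrable lebesgue f" and ray: "\<And>x. (LINT y:{x<..}|lebesgue. f y) = 0"
  shows "AE x in lebesgue. f x = 0"
proof -
  from completion_ex_borel_measurable_real[OF borel_measurable_integrable[OF f]]
  obtain g where g: "g \<in> borel_measurable lborel" and eq: "AE x in lborel. f x = g x" by blast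
  have eq': "AE x in lebesgue. f x = g x" using eq by (rule AE_completion)
  have gi': "integrable lebesgue g"
    using f g eq' integrable_cong_AE[of f lebesgue g]
    by (auto intro: borel_measurable_integrable simp: measurable_completion)
  then have gi: "integrable lborel g" using g integrable_completion by blast
  have ray_g: "(LINT y|lborel. indicator {x<..} y * g y) = 0" for x
  proof -
    have "(LINT y|lborel. indicator {x<..} y * g y) = (LINT y|lebesgue. indicator {x<..} y * g y)"
      using g by (intro integral_completion[symmetric]) simp
    also have "\<dots> = (LINT y|lebesgue. indicator {x<..} y *\<^sub>R f y)"
    proof (rule integral_cong_AE)
      show "(\<lambda>y. indicator {x<..} y * g y) \<in> borel_measurable lebesgue"
        using g by (intro measurable_completion) simp
      show "(\<lambda>y. indicator {x<..} y *\<^sub>R f y) \<in> borel_measurable lebesgue"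
        using borel_measurable_integrable[OF f] by (intro borel_measurable_scaleR) (auto intro: measurable_completion)
    qed (use eq' in auto)
    also have "\<dots> = 0" using ray by (simp add: set_lebesgue_integral_def)
    finally show ?thesis .
  qed
  define P where "P = density lborel (\<lambda>x. ennreal (max 0 (g x)))"
  define N where "N = density lborel (\<lambda>x. ennreal (max 0 (- g x)))"
  note [measurable] = g
  have ip: "integrable lborel (\<lambda>y. indicator {x<..} y * max 0 (g y))"
    and im: "integrable lborel (\<lambda>y. indicator {x<..} y * max 0 (- g y))" for x
    using gi by (auto intro!: integrable_real_mult_indicator simp: mult.commute[of "indicator _ _"])
  have eP: "emeasure P {x<..} = ennreal (LINT y|lborel. indicator {x<..} y * max 0 (g y))" for x
  proof -
    have "emeasure P {x<..} = (\<integral>\<^sup>+y. ennreal (indicator {x<..} y * max 0 (g y)) \<partial>lborel)"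
      unfolding P_def by (subst emeasure_density) (auto intro!: nn_integral_cong simp: indicator_def)
    also have "\<dots> = ennreal (LINT y|lborel. indicator {x<..} y * max 0 (g y))"
      using ip by (intro nn_integral_eq_integral) auto
    finally show ?thesis .
  qed
  have eN: "emeasure N {x<..} = ennreal (LINT y|lborel. indicator {x<..} y * max 0 (- g y))" for x
  proof -
    have "emeasure N {x<..} = (\<integral>\<^sup>+y. ennreal (indicator {x<..} y * max 0 (- g y)) \<partial>lborel)"
      unfolding N_def by (subst emeasure_density) (auto intro!: nn_integral_cong simp: indicator_def)
    also have "\<dots> = ennreal (LINT y|lborel. indicator {x<..} y * max 0 (- g y))"
      using im by (intro nn_integral_eq_integral) auto
    finally show ?thesis .
  qed
  have "(LINT y|lborel. indicator {x<..} y * max 0 (g y)) - (LINT y|lborel. indicator {x<..} y * max 0 (- g y))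
      = (LINT y|lborel. indicator {x<..} y * g y)" for x
    by (subst Bochner_Integration.integral_diff[OF ip im, symmetric])
      (auto intro!: Bochner_Integration.integral_cong simp: max_def algebra_simps)
  then have "emeasure P {x<..} = emeasure N {x<..}" for x
    using ray_g by (simp add: eP eN)
  moreover have "sets P = sets borel" "sets N = sets borel" by (simp_all add: P_def N_def)
  moreover have "emeasure P {x<..} < \<infinity>" for x by (simp add: eP)
  ultimately have "P = N" by (intro measure_eqI_lessThan)
  then have "AE x in lborel. ennreal (max 0 (g x)) = ennreal (max 0 (- g x))"
    unfolding P_def N_def by (intro sigma_finite_measure.density_unique[OF lborel.sigma_finite_measure_axioms]) auto
  then have "AE x in lborel. g x = 0"
    by eventually_elim (auto simp: max_def split: if_splits)
  then have "AE x in lebesgue. g x = 0" by (rule AE_completion)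
  with eq' show ?thesis by eventually_elim simp
qed

lemma AE_eq_0_on_if_interval_integrals_eq_0:
  fixes f :: "real \<Rightarrow> real"
  assumes f: "set_integrable lebesgue {c..d} f"
    and ivl: "\<And>x. c \<le> x \<Longrightarrow> x < d \<Longrightarrow> (LINT y:{x..d}|lebesgue. f y) = 0"
  shows "AE x in lebesgue. x \<in> {c..d} \<longrightarrow> f x = 0"
proof -
  have "AE x in lebesgue. indicator {c..d} x *\<^sub>R f x = 0"
  proof (rule AE_eq_0_if_ray_integrals_eq_0)
    show "integrable lebesgue (\<lambda>x. indicator {c..d} x *\<^sub>R f x)"
      using f by (simp add: set_integrable_def)
    fix x
    have "(LINT y:{x<..}|lebesgue. indicator {c..d} y *\<^sub>R f y) = (LINT y:{max x c..d}|lebesgue. f y)"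
    proof -
      have "(LINT y:{x<..}|lebesgue. indicator {c..d} y *\<^sub>R f y) = (LINT y:{x<..} \<inter> {c..d}|lebesgue. f y)"
        unfolding set_lebesgue_integral_def
        by (intro Bochner_Integration.integral_cong) (auto simp: indicator_def)
      also have "\<dots> = (LINT y:{max x c..d}|lebesgue. f y)"
        by (rule set_integral_discrete_difference[of "{x}"]) auto
      finally show ?thesis .
    qed
    also have "\<dots> = 0"
    proof (cases "max x c < d")
      case False
      then have "(LINT y:{max x c..d}|lebesgue. f y) = (LINT y:{}|lebesgue. f y)"
        by (intro set_integral_discrete_difference[of "{d}"]) auto
      then show ?thesis by (simp add: set_lebesgue_integral_def)
    qed (use ivl in auto)
    finally show "(LINT y:{x<..}|lebesgue. indicator {c..d} y *\<^sub>R f y) = 0" .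
  qed
  then show ?thesis by eventually_elim (auto simp: indicator_def)
qed

text \<open>
  Testing with the cutoffs of a compact subinterval shows that \<open>g\<close> has integral \<open>0\<close> over it. As
  \<open>g\<close> need only be locally integrable, the conclusion is drawn on an exhausting sequence of
  compact intervals.
\<close>
lemma fundamental_lemma_of_variations:
  assumes g: "locally_integrable a b g"
    and orth: "\<And>\<phi>. test_function a b \<phi> \<Longrightarrow> (LINT x:{a<..<b}|lebesgue. g x * \<phi> x) = 0"
  shows "AE x in lebesgue. x \<in> {a<..<b} \<longrightarrow> g x = 0"
proof -
  have sub: "(LINT x:{c..d}|lebesgue. g x) = 0" if cd: "a < c" "d < b" for c d
  proof -
    have "(LINT x:{c..d}|lebesgue. g x * cutoff c d m x) = 0" for m
    proof -
      have out: "cutoff c d m x = 0" if "x \<notin> {c..d}" for x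
      proof (rule cutoff_eq_0)
        have "0 < 1 / real (Suc m)" by simp
        then show "x \<notin> {c + 1 / real (Suc m)..d - 1 / real (Suc m)}"
          using that unfolding atLeastAtMost_iff by linarith
      qed
      have "test_function a b (cutoff c d m)"
        using smooth_cutoff[of c d m] cd out unfolding test_function_def smooth_def by blast
      from orth[OF this] have "(LINT x:{a<..<b}|lebesgue. g x * cutoff c d m x) = 0" .
      also have "(LINT x:{a<..<b}|lebesgue. g x * cutoff c d m x) = (LINT x:{c..d}|lebesgue. g x * cutoff c d m x)"
        unfolding set_lebesgue_integral_def
        using cd out by (intro Bochner_Integration.integral_cong) (auto simp: indicator_def)
      finally show ?thesis .
    qed
    moreover have "set_integrable lebesgue {c..d} g"
      using g cd by (simp add: locally_integrable_def)
    ultimately show ?thesis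
      using set_integral_mult_cutoff_tendsto[of c d g] by (simp add: LIMSEQ_const_iff)
  qed
  have "AE x in lebesgue. \<forall>m::nat. x \<in> {a + 1 / real (Suc m)..b - 1 / real (Suc m)} \<longrightarrow> g x = 0"
    unfolding AE_all_countable
  proof
    fix m :: nat
    have m: "a < a + 1 / real (Suc m)" "b - 1 / real (Suc m) < b" by simp_all
    show "AE x in lebesgue. x \<in> {a + 1 / real (Suc m)..b - 1 / real (Suc m)} \<longrightarrow> g x = 0"
    proof (rule AE_eq_0_on_if_interval_integrals_eq_0)
      show "set_integrable lebesgue {a + 1 / real (Suc m)..b - 1 / real (Suc m)} g"
        using g m unfolding locally_integrable_def by blast
      show "(LINT y:{x..b - 1 / real (Suc m)}|lebesgue. g y) = 0" if "a + 1 / real (Suc m) \<le> x" for x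
        by (rule sub) (use that m in linarith)+
    qed
  qed
  moreover have "\<exists>m::nat. x \<in> {a + 1 / real (Suc m)..b - 1 / real (Suc m)}" if x: "x \<in> {a<..<b}" for x
  proof -
    obtain m where m: "inverse (real (Suc m)) < min (x - a) (b - x)"
      using reals_Archimedean[of "min (x - a) (b - x)"] x by auto
    then have "a + 1 / real (Suc m) \<le> x \<and> x \<le> b - 1 / real (Suc m)"
      unfolding inverse_eq_divide by linarith
    then show ?thesis by (intro exI[of _ m]) simp
  qed
  ultimately show ?thesis by (auto elim!: eventually_mono)
qed

lemma continuous_on_Icc_bounded:
  fixes f :: "real \<Rightarrow> real"
  assumes "continuous_on {a..b} f"
  obtains C where "C \<ge> 0" "\<And>x. x \<in> {a..b} \<Longrightarrow> \<bar>f x\<bar> \<le> C"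
proof -
  have "bounded (f ` {a..b})" using assms by (intro compact_imp_bounded compact_continuous_image) auto
  then obtain C where C: "\<forall>x\<in>{a..b}. \<bar>f x\<bar> \<le> C" by (auto simp: bounded_iff)
  show ?thesis by (rule that[of "max C 0"]) (use C in \<open>auto simp: le_max_iff_disj\<close>)
qed

lemma test_function_bounded:
  assumes "test_function a b \<phi>"
  obtains C where "\<And>x. \<bar>\<phi> x\<bar> \<le> C"
proof -
  from assms obtain c d where cd: "\<And>x. x \<notin> {c..d} \<Longrightarrow> \<phi> x = 0"
    unfolding test_function_def by blast
  obtain C where C: "C \<ge> 0" "\<And>x. x \<in> {c..d} \<Longrightarrow> \<bar>\<phi> x\<bar> \<le> C"
    using continuous_on_Icc_bounded[OF smooth_continuous_on[OF test_function_smooth[OF assms]]] by blast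
  have "\<bar>\<phi> x\<bar> \<le> C" for x
    using C cd[of x] by (cases "x \<in> {c..d}") auto
  then show ?thesis by (rule that)
qed

lemma set_integrable_mult_test_function:
  assumes f: "locally_integrable a b f" and \<phi>: "test_function a b \<phi>"
  shows "set_integrable lebesgue {a<..<b} (\<lambda>x. f x * \<phi> x)"
proof -
  from \<phi> obtain c d where cd: "a < c" "d < b" "\<And>x. x \<notin> {c..d} \<Longrightarrow> \<phi> x = 0"
    unfolding test_function_def by blast
  obtain C where C: "\<And>x. \<bar>\<phi> x\<bar> \<le> C" using test_function_bounded[OF \<phi>] by blast
  have "set_integrable lebesgue {c..d} (\<lambda>x. f x * \<phi> x)"
    using f cd C test_function_smooth[OF \<phi>] smooth_continuous_on
    by (intro set_integrable_mult_bounded[where C = C]) (auto simp: locally_integrable_def)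
  moreover have "(\<lambda>x. indicator {c..d} x *\<^sub>R (f x * \<phi> x)) = (\<lambda>x. indicator {a<..<b} x *\<^sub>R (f x * \<phi> x))"
    using cd by (auto simp: indicator_def fun_eq_iff)
  ultimately show ?thesis by (simp add: set_integrable_def)
qed

lemma has_weak_derivative_unique:
  assumes g: "has_weak_derivative a b f g" and g': "has_weak_derivative a b f g'"
  shows "AE x in lebesgue. x \<in> {a<..<b} \<longrightarrow> g x = g' x"
proof -
  have "AE x in lebesgue. x \<in> {a<..<b} \<longrightarrow> g x - g' x = 0"
  proof (rule fundamental_lemma_of_variations)
    show "locally_integrable a b (\<lambda>x. g x - g' x)"
      using g g' by (auto simp: has_weak_derivative_def locally_integrable_def)
    fix \<phi> assume \<phi>: "test_function a b \<phi>"
    have "(LINT x:{a<..<b}|lebesgue. (g x - g' x) * \<phi> x) =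
        (LINT x:{a<..<b}|lebesgue. g x * \<phi> x) - (LINT x:{a<..<b}|lebesgue. g' x * \<phi> x)"
      using g g' \<phi> by (subst set_integral_diff(2)[symmetric])
        (auto simp: has_weak_derivative_def left_diff_distrib intro: set_integrable_mult_test_function)
    also have "(LINT x:{a<..<b}|lebesgue. g x * \<phi> x) = - (LINT x:{a<..<b}|lebesgue. f x * deriv \<phi> x)"
      using g \<phi> unfolding has_weak_derivative_def by simp
    also have "(LINT x:{a<..<b}|lebesgue. g' x * \<phi> x) = - (LINT x:{a<..<b}|lebesgue. f x * deriv \<phi> x)"
      using g' \<phi> unfolding has_weak_derivative_def by simp
    also have "- (LINT x:{a<..<b}|lebesgue. f x * deriv \<phi> x) - - (LINT x:{a<..<b}|lebesgue. f x * deriv \<phi> x) = 0"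
      by simp
    finally show "(LINT x:{a<..<b}|lebesgue. (g x - g' x) * \<phi> x) = 0" .
  qed
  then show ?thesis by simp
qed

lemma set_integral_FTC:
  fixes F f :: "real \<Rightarrow> real"
  assumes "c \<le> d" and F: "\<And>x. (F has_real_derivative f x) (at x)" and f: "continuous_on {c..d} f"
  shows "(LINT x:{c..d}|lebesgue. f x) = F d - F c"
proof -
  have "(f has_integral F d - F c) {c..d}"
    using assms by (intro fundamental_theorem_of_calculus)
      (auto intro: has_field_derivative_at_within simp flip: has_real_derivative_iff_has_vector_derivative)
  then show ?thesis
    using set_lebesgue_integral_eq_integral(2)[OF absolutely_integrable_continuous_real[OF f]]
    by (simp add: integral_unique)
qed

lemma DERIV_rescaled_flat_exp:
  "((\<lambda>x. flat_exp 0 (q * x + p)) has_real_derivative q * flat_exp 2 (q * x + p)) (at x)"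
proof -
  have "((\<lambda>x. flat_exp 0 (q * x + p)) has_real_derivative
      (flat_exp (0 + 2) (q * x + p) + (- real 0) * flat_exp (0 + 1) (q * x + p)) * q) (at x)"
    by (rule DERIV_chain2[OF DERIV_flat_exp]) (auto intro!: derivative_eq_intros)
  then show ?thesis by (simp add: mult.commute numeral_2_eq_2)
qed

section \<open>Integration by parts up to the boundary\<close>

text \<open>
  The derivative of the cutoff concentrates at the two endpoints, where \<open>w\<close> vanishes. With
  \<open>L\<close> and \<open>R\<close> the rising and the falling factor of the cutoff, its derivative is bounded in modulus by the
  derivative of the increasing function \<open>K = L - R\<close>. Over the whole interval that derivative has integral
  at most \<open>2\<close>, and over a compact subinterval its integral tends to \<open>0\<close>. Splitting the interval
  into a neighbourhood of the endpoints, in which \<open>w\<close> is small, and the rest gives the limit.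
\<close>
lemma integral_mult_deriv_cutoff_tendsto_0:
  fixes w :: "real \<Rightarrow> real"
  assumes ab: "a < b" and w: "continuous_on {a..b} w" and w0: "w a = 0" "w b = 0"
  shows "(\<lambda>m. LINT x:{a..b}|lebesgue. w x * deriv (cutoff a b m) x) \<longlonglongrightarrow> 0"
proof -
  define L where "L = (\<lambda>m x. flat_exp 0 (real (Suc m) * (x - a) - 1))"
  define R where "R = (\<lambda>m x. flat_exp 0 (real (Suc m) * (b - x) - 1))"
  define L' where "L' = (\<lambda>m x. real (Suc m) * flat_exp 2 (real (Suc m) * (x - a) - 1))"
  define R' where "R' = (\<lambda>m x. real (Suc m) * flat_exp 2 (real (Suc m) * (b - x) - 1))"
  define K where "K = (\<lambda>m x. L m x - R m x)"
  define K' where "K' = (\<lambda>m x. L' m x + R' m x)"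
  have L: "(L m has_real_derivative L' m x) (at x)" for m x
    using DERIV_rescaled_flat_exp[of "real (Suc m)" "- real (Suc m) * a - 1" x]
    by (simp add: L_def L'_def algebra_simps)
  have R: "(R m has_real_derivative - R' m x) (at x)" for m x
    using DERIV_rescaled_flat_exp[of "- real (Suc m)" "real (Suc m) * b - 1" x]
    by (simp add: R_def R'_def algebra_simps)
  have K: "(K m has_real_derivative K' m x) (at x)" for m x
    using DERIV_diff[OF L[of m x] R[of m x]] by (simp add: K_def K'_def)
  have nonneg: "L m x \<ge> 0" "R m x \<ge> 0" "L' m x \<ge> 0" "R' m x \<ge> 0" for m x
    by (simp_all add: L_def R_def L'_def R'_def flat_exp_nonneg)
  have le1: "L m x \<le> 1" "R m x \<le> 1" for m x
    by (simp_all add: L_def R_def flat_exp_0_le_1)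
  have K'c: "continuous_on S (K' m)" for S m
    unfolding K'_def L'_def R'_def
    by (intro continuous_intros continuous_on_compose2[OF smooth_continuous_on[OF smooth_flat_exp, of UNIV]]) auto
  have cutoff: "cutoff a b m = (\<lambda>x. L m x * R m x)" for m
    by (simp add: cutoff_def L_def R_def fun_eq_iff)
  have bound: "\<bar>deriv (cutoff a b m) x\<bar> \<le> K' m x" for m x
  proof -
    have "deriv (cutoff a b m) x = L' m x * R m x - R' m x * L m x"
      unfolding cutoff using DERIV_mult[OF L[of m x] R[of m x]] by (simp add: DERIV_imp_deriv)
    also have "\<bar>\<dots>\<bar> \<le> L' m x * R m x + R' m x * L m x"
      using nonneg by (auto intro!: abs_triangle_ineq4[THEN order_trans] simp: abs_mult)
    also have "\<dots> \<le> L' m x * 1 + R' m x * 1"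
      using nonneg le1 by (intro add_mono mult_left_mono) auto
    finally show ?thesis by (simp add: K'_def)
  qed
  obtain M where M: "M \<ge> 0" "\<And>x. x \<in> {a..b} \<Longrightarrow> \<bar>w x\<bar> \<le> M"
    using continuous_on_Icc_bounded[OF w] by blast
  show ?thesis
  proof (rule tendstoI)
    fix e :: real assume e: "e > 0"
    \<comment> \<open>The endpoints contribute at most twice this bound, which leaves room for the interior.\<close>
    define \<eta> where "\<eta> = e / 4"
    have \<eta>: "\<eta> > 0" using e by (simp add: \<eta>_def)
    have "continuous (at a within {a..b}) w" "continuous (at b within {a..b}) w"
      using w ab by (auto simp: continuous_on_eq_continuous_within)
    then obtain \<delta>1 \<delta>2 where \<delta>1: "\<delta>1 > 0" "\<And>x. x \<in> {a..b} \<Longrightarrow> \<bar>x - a\<bar> < \<delta>1 \<Longrightarrow> \<bar>w x\<bar> < \<eta>"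
      and \<delta>2: "\<delta>2 > 0" "\<And>x. x \<in> {a..b} \<Longrightarrow> \<bar>x - b\<bar> < \<delta>2 \<Longrightarrow> \<bar>w x\<bar> < \<eta>"
      using \<eta> w0 unfolding continuous_within_eps_delta dist_real_def by (metis diff_zero)
    define \<delta> where "\<delta> = min (min \<delta>1 \<delta>2) ((b - a) / 3)"
    have \<delta>: "\<delta> > 0" "\<delta> \<le> \<delta>1" "\<delta> \<le> \<delta>2"
      using \<delta>1(1) \<delta>2(1) ab by (auto simp: \<delta>_def)
    have "\<delta> \<le> (b - a) / 3" unfolding \<delta>_def by (rule min.cobounded2)
    then have "a + \<delta> < b - \<delta>" using ab by (simp add: field_simps)
    define c where "c = a + \<delta>"
    define d where "d = b - \<delta>"
    have cd: "a < c" "c < d" "d < b" using \<delta> \<open>a + \<delta> < b - \<delta>\<close> by (auto simp: c_def d_def)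
    have near: "\<bar>w x\<bar> \<le> \<eta>" if "x \<in> {a..b}" "x \<notin> {c..d}" for x
    proof -
      have "\<bar>x - a\<bar> < \<delta>1 \<or> \<bar>x - b\<bar> < \<delta>2" using that \<delta> by (auto simp: c_def d_def)
      then show ?thesis using \<delta>1(2) \<delta>2(2) that(1) by (meson less_imp_le)
    qed
    have est: "\<bar>LINT x:{a..b}|lebesgue. w x * deriv (cutoff a b m) x\<bar> \<le> 2 * \<eta> + M * (K m d - K m c)" for m
    proof -
      define g where "g = (\<lambda>x. \<eta> * K' m x + M * (indicator {c..d} x * K' m x))"
      have Ki: "set_integrable lebesgue {s..t} (K' m)" for s t
        by (intro absolutely_integrable_continuous_real K'c)
      have ind: "(\<lambda>x. indicator {a..b} x *\<^sub>R (indicator {c..d} x * K' m x)) = (\<lambda>x. indicator {c..d} x *\<^sub>R K' m x)"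
        using cd by (auto simp: indicator_def fun_eq_iff)
      have Kci: "set_integrable lebesgue {a..b} (\<lambda>x. indicator {c..d} x * K' m x)"
        using Ki[of c d] by (simp add: set_integrable_def ind del: real_scaleR_def)
      have wi: "set_integrable lebesgue {a..b} (\<lambda>x. w x * deriv (cutoff a b m) x)"
        by (intro absolutely_integrable_continuous_real continuous_on_mult w
            smooth_continuous_on smooth_deriv smooth_cutoff)
      have "\<bar>LINT x:{a..b}|lebesgue. w x * deriv (cutoff a b m) x\<bar>
          \<le> (LINT x:{a..b}|lebesgue. \<bar>w x * deriv (cutoff a b m) x\<bar>)"
        using set_integral_norm_bound[OF wi] by simp
      also have "\<dots> \<le> (LINT x:{a..b}|lebesgue. g x)"
      proof (rule set_integral_mono)
        show "set_integrable lebesgue {a..b} (\<lambda>x. \<bar>w x * deriv (cutoff a b m) x\<bar>)"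
          using wi by (rule set_integrable_abs)
        show "set_integrable lebesgue {a..b} g"
          unfolding g_def using Ki Kci by (intro set_integral_add set_integrable_mult_right) auto
        fix x assume x: "x \<in> {a..b}"
        have K0: "K' m x \<ge> 0" using nonneg by (simp add: K'_def)
        have "\<bar>w x\<bar> \<le> \<eta> + M * indicator {c..d} x"
          using near[OF x] M(2)[OF x] \<eta> by (auto simp: indicator_def)
        then have "\<bar>w x\<bar> * \<bar>deriv (cutoff a b m) x\<bar> \<le> (\<eta> + M * indicator {c..d} x) * K' m x"
          using bound[of m x] K0 M(1) \<eta> by (intro mult_mono) auto
        then show "\<bar>w x * deriv (cutoff a b m) x\<bar> \<le> g x"
          by (simp add: g_def abs_mult algebra_simps)
      qed
      also have "\<dots> = \<eta> * (LINT x:{a..b}|lebesgue. K' m x) + M * (LINT x:{c..d}|lebesgue. K' m x)"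
      proof -
        have "(LINT x:{a..b}|lebesgue. indicator {c..d} x * K' m x) = (LINT x:{c..d}|lebesgue. K' m x)"
          by (simp add: set_lebesgue_integral_def ind del: real_scaleR_def)
        then show ?thesis
          unfolding g_def using Ki Kci by (subst set_integral_add(2)) auto
      qed
      also have "\<dots> = \<eta> * (K m b - K m a) + M * (K m d - K m c)"
        using set_integral_FTC[OF _ K K'c] ab cd by simp
      also have "\<dots> \<le> \<eta> * 2 + M * (K m d - K m c)"
      proof -
        have "K m b - K m a \<le> 2"
          unfolding K_def using nonneg(1)[of m a] nonneg(2)[of m b] le1(1)[of m b] le1(2)[of m a] by linarith
        then show ?thesis using \<eta> by simp
      qed
      finally show ?thesis by simp
    qed
    have K0: "(\<lambda>m. K m x) \<longlonglongrightarrow> 0" if "a < x" "x < b" for x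
      using tendsto_diff[OF rescaled_flat_exp_tendsto_1 rescaled_flat_exp_tendsto_1, of "x - a" "b - x"] that
      by (simp add: K_def L_def R_def)
    have "(\<lambda>m. 2 * \<eta> + M * (K m d - K m c)) \<longlonglongrightarrow> 2 * \<eta> + M * (0 - 0)"
      using cd by (intro tendsto_intros K0) auto
    then have "eventually (\<lambda>m. 2 * \<eta> + M * (K m d - K m c) < e) sequentially"
      by (rule order_tendstoD) (use e in \<open>simp add: \<eta>_def\<close>)
    then show "eventually (\<lambda>m. dist (LINT x:{a..b}|lebesgue. w x * deriv (cutoff a b m) x) 0 < e) sequentially"
      by eventually_elim (use est le_less_trans in \<open>auto simp: dist_real_def\<close>)
  qed
qed

text \<open>
  The definition of a weak derivative allows only \<open>\<phi>\<close> with compact support in \<open>(a, b)\<close>. It is applied to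
  \<open>\<phi>\<close> times a cutoff; in the limit, the term with the derivative of the cutoff disappears because
  \<open>w\<close> vanishes at both ends.
\<close>
lemma integration_by_parts_weak_derivative:
  fixes w w' \<phi> :: "real \<Rightarrow> real"
  assumes ab: "a < b" and w: "continuous_on {a..b} w" and w0: "w a = 0" "w b = 0"
    and w': "has_weak_derivative a b w w'" and i: "set_integrable lebesgue {a..b} w'" and \<phi>: "smooth \<phi>"
  shows "(LINT x:{a..b}|lebesgue. w x * deriv \<phi> x) = - (LINT x:{a..b}|lebesgue. w' x * \<phi> x)"
proof -
  note cont = w smooth_continuous_on[OF \<phi>] smooth_continuous_on[OF smooth_deriv[OF \<phi>]]
    smooth_continuous_on[OF smooth_cutoff] smooth_continuous_on[OF smooth_deriv[OF smooth_cutoff]]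
  obtain C where C: "\<And>x. x \<in> {a..b} \<Longrightarrow> \<bar>\<phi> x\<bar> \<le> C"
    using continuous_on_Icc_bounded[OF smooth_continuous_on[OF \<phi>]] by blast
  have i\<phi>: "set_integrable lebesgue {a..b} (\<lambda>x. w' x * \<phi> x)"
    using i smooth_continuous_on[OF \<phi>] C by (rule set_integrable_mult_bounded)
  have iw: "set_integrable lebesgue {a..b} (\<lambda>x. w x * deriv \<phi> x)"
    by (intro absolutely_integrable_continuous_real continuous_on_mult cont)
  have eq: "(LINT x:{a..b}|lebesgue. (w x * deriv \<phi> x) * cutoff a b m x)
      + (LINT x:{a..b}|lebesgue. (w x * \<phi> x) * deriv (cutoff a b m) x)
      = - (LINT x:{a..b}|lebesgue. (w' x * \<phi> x) * cutoff a b m x)" for m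
  proof -
    have d: "deriv (\<lambda>x. \<phi> x * cutoff a b m x) x = deriv \<phi> x * cutoff a b m x + deriv (cutoff a b m) x * \<phi> x" for x
      by (intro DERIV_imp_deriv DERIV_mult smooth_DERIV smooth_cutoff \<phi>)
    have "(LINT x:{a..b}|lebesgue. (w x * deriv \<phi> x) * cutoff a b m x)
      + (LINT x:{a..b}|lebesgue. (w x * \<phi> x) * deriv (cutoff a b m) x)
      = (LINT x:{a..b}|lebesgue. w x * deriv (\<lambda>x. \<phi> x * cutoff a b m x) x)"
      unfolding d
      by (subst set_integral_add(2)[symmetric])
        (auto simp: algebra_simps intro!: absolutely_integrable_continuous_real continuous_on_mult cont)
    also have "\<dots> = - (LINT x:{a..b}|lebesgue. w' x * (\<phi> x * cutoff a b m x))"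
      using w' test_function_mult_cutoff[OF \<phi>, of a b m]
      by (simp add: has_weak_derivative_def set_integral_open_interval)
    finally show ?thesis by (simp add: mult.assoc)
  qed
  have "(\<lambda>m. (LINT x:{a..b}|lebesgue. (w x * deriv \<phi> x) * cutoff a b m x)
      + (LINT x:{a..b}|lebesgue. (w x * \<phi> x) * deriv (cutoff a b m) x))
      \<longlonglongrightarrow> (LINT x:{a..b}|lebesgue. w x * deriv \<phi> x) + 0"
    using w0 by (intro tendsto_add set_integral_mult_cutoff_tendsto iw integral_mult_deriv_cutoff_tendsto_0 ab
        continuous_on_mult cont) auto
  moreover have "(\<lambda>m. - (LINT x:{a..b}|lebesgue. (w' x * \<phi> x) * cutoff a b m x))
      \<longlonglongrightarrow> - (LINT x:{a..b}|lebesgue. w' x * \<phi> x)"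
    by (intro tendsto_minus set_integral_mult_cutoff_tendsto i\<phi>)
  ultimately show ?thesis
    unfolding eq using LIMSEQ_unique by fastforce
qed

section \<open>Set integrals on the line and the calculus of weak derivatives\<close>

text \<open>
  Unlike the general congruence rule for almost everywhere equal functions, this one asks for no
  measurability of \<open>g\<close>, because Lebesgue measure is complete. It is applied to products of unspecified
  representatives of weak derivatives.
\<close>
lemma set_integral_lebesgue_cong_AE:
  fixes f g :: "real \<Rightarrow> real"
  assumes f: "set_integrable lebesgue S f" and eq: "AE x in lebesgue. x \<in> S \<longrightarrow> g x = f x"
  shows "set_integrable lebesgue S g" "(LINT x:S|lebesgue. g x) = (LINT x:S|lebesgue. f x)"
proof -
  obtain N where N: "negligible N" "{x. \<not> (x \<in> S \<longrightarrow> g x = f x)} \<subseteq> N"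
    using eq by (auto simp: eventually_ae_filter_negligible)
  then have *: "g x = f x" if "x \<in> S - N" for x using that by auto
  show g: "set_integrable lebesgue S g"
    using f N(1) * by (rule absolutely_integrable_spike)
  show "(LINT x:S|lebesgue. g x) = (LINT x:S|lebesgue. f x)"
    using set_lebesgue_integral_eq_integral(2)[OF f] set_lebesgue_integral_eq_integral(2)[OF g]
      integral_spike[OF N(1), of S f g] * by simp
qed

lemma set_integral_combine_Icc:
  fixes f :: "real \<Rightarrow> real"
  assumes "a \<le> c" "c \<le> b"
    and 1: "set_integrable lebesgue {a..c} f" and 2: "set_integrable lebesgue {c..b} f"
  shows "set_integrable lebesgue {a..b} f"
    and "(LINT x:{a..b}|lebesgue. f x) = (LINT x:{a..c}|lebesgue. f x) + (LINT x:{c..b}|lebesgue. f x)"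
proof -
  have un: "{a..b} = {a..c} \<union> {c..b}" using assms by auto
  show "set_integrable lebesgue {a..b} f"
    unfolding un using 1 2 by (rule set_integrable_Un) auto
  have "AE x in lebesgue. x \<noteq> c" by (rule AE_I[of _ _ "{c}"]) auto
  then have "AE x in lebesgue. \<not> (x \<in> {a..c} \<and> x \<in> {c..b})" by eventually_elim auto
  then show "(LINT x:{a..b}|lebesgue. f x) = (LINT x:{a..c}|lebesgue. f x) + (LINT x:{c..b}|lebesgue. f x)"
    unfolding un using 1 2 by (intro set_integral_Un_AE) auto
qed

lemma
  fixes f :: "real \<Rightarrow> real"
  shows set_integrable_translate:
      "set_integrable lebesgue {t + a..t + b} f \<longleftrightarrow> set_integrable lebesgue {a..b} (\<lambda>x. f (t + x))"
    and set_integral_translate: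
      "(LINT x:{t + a..t + b}|lebesgue. f x) = (LINT x:{a..b}|lebesgue. f (t + x))"
proof -
  have eq: "(\<lambda>x. indicator {t + a..t + b} (t + 1 * x) *\<^sub>R f (t + 1 * x)) = (\<lambda>x. indicator {a..b} x *\<^sub>R f (t + x))"
    by (auto simp: indicator_def fun_eq_iff)
  show "set_integrable lebesgue {t + a..t + b} f \<longleftrightarrow> set_integrable lebesgue {a..b} (\<lambda>x. f (t + x))"
    unfolding set_integrable_def
    by (subst lebesgue_integrable_real_affine_iff[of 1 _ t, symmetric], simp) (simp only: eq)
  show "(LINT x:{t + a..t + b}|lebesgue. f x) = (LINT x:{a..b}|lebesgue. f (t + x))"
    unfolding set_lebesgue_integral_def
    by (subst lebesgue_integral_real_affine[of 1 _ t]) (simp_all only: eq, simp_all)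
qed

lemma locally_integrable_add:
  "locally_integrable a b f \<Longrightarrow> locally_integrable a b g \<Longrightarrow> locally_integrable a b (\<lambda>x. f x + g x)"
  by (auto simp: locally_integrable_def)

lemma locally_integrable_mult_right:
  "locally_integrable a b f \<Longrightarrow> locally_integrable a b (\<lambda>x. r * f x)"
  by (auto simp: locally_integrable_def)

lemma test_function_deriv:
  assumes "test_function a b \<phi>"
  shows "test_function a b (deriv \<phi>)"
proof -
  from assms obtain c d where cd: "a < c" "d < b" "\<And>x. x \<notin> {c..d} \<Longrightarrow> \<phi> x = 0"
    unfolding test_function_def by blast
  have "deriv \<phi> x = 0" if "x \<notin> {c..d}" for x
  proof (rule DERIV_imp_deriv)
    show "(\<phi> has_real_derivative 0) (at x)"
      by (rule has_field_derivative_transform_within_open[of "\<lambda>x. 0" _ _ "- {c..d}"])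
        (use that cd in auto)
  qed
  then show ?thesis
    using smooth_deriv[OF test_function_smooth[OF assms]] cd(1,2)
    unfolding test_function_def smooth_def by blast
qed

lemma has_weak_derivative_zero: "has_weak_derivative a b (\<lambda>x. 0) (\<lambda>x. 0)"
  by (simp add: has_weak_derivative_def locally_integrable_def set_integrable_def)

lemma has_weak_derivative_add:
  assumes "has_weak_derivative a b f f'" "has_weak_derivative a b g g'"
  shows "has_weak_derivative a b (\<lambda>x. f x + g x) (\<lambda>x. f' x + g' x)"
  using assms unfolding has_weak_derivative_def
  by (auto simp: locally_integrable_add distrib_right set_integral_add(2) set_integrable_mult_test_function
      test_function_deriv)

lemma has_weak_derivative_mult_right:
  assumes "has_weak_derivative a b f f'"
  shows "has_weak_derivative a b (\<lambda>x. r * f x) (\<lambda>x. r * f' x)"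
  using assms unfolding has_weak_derivative_def
  by (simp add: locally_integrable_mult_right mult.assoc)

lemma has_weak_derivative_sum:
  assumes "finite I" "\<And>i. i \<in> I \<Longrightarrow> has_weak_derivative a b (f i) (f' i)"
  shows "has_weak_derivative a b (\<lambda>x. \<Sum>i\<in>I. f i x) (\<lambda>x. \<Sum>i\<in>I. f' i x)"
  using assms
  by (induction I rule: finite_induct) (simp_all add: has_weak_derivative_zero has_weak_derivative_add)

lemma AE_weak_deriv_eq:
  assumes "has_weak_derivative a b f g"
  shows "AE x in lebesgue. x \<in> {a<..<b} \<longrightarrow> weak_deriv a b f x = g x"
  unfolding weak_deriv_def
  using someI[of "has_weak_derivative a b f", OF assms] assms by (rule has_weak_derivative_unique)

section \<open>The ramp of a bubble\<close>

text \<open>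
  The function that is \<open>0\<close> left of the cell \<open>[0, h]\<close>, equal to \<open>x/h + B(x)\<close> on it, and \<open>1\<close> to the right.
  Clamping the argument to the cell makes continuity immediate.
\<close>
definition ramp :: "real \<Rightarrow> (real \<Rightarrow> real) \<Rightarrow> real \<Rightarrow> real" where
  "ramp h B x = max 0 (min h x) / h + B (max 0 (min h x))"

definition ramp_slope :: "real \<Rightarrow> (real \<Rightarrow> real) \<Rightarrow> real \<Rightarrow> real" where
  "ramp_slope h B' x = indicator {0..h} x * (1 / h + B' x)"

locale cell_bubble =
  fixes h :: real and B B' :: "real \<Rightarrow> real"
  assumes h: "h > 0" and B_cont: "continuous_on {0..h} B" and B0: "B 0 = 0" and Bh: "B h = 0"
    and B_weak: "has_weak_derivative 0 h B B'" and B'_int: "set_integrable lebesgue {0..h} B'"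
begin

lemma ramp_cell: "x \<in> {0..h} \<Longrightarrow> ramp h B x = x / h + B x"
  by (simp add: ramp_def)

lemma ramp_left: "x \<le> 0 \<Longrightarrow> ramp h B x = 0"
  using h B0 by (simp add: ramp_def max_def min_def)

lemma ramp_right: "x \<ge> h \<Longrightarrow> ramp h B x = 1"
  using h Bh by (simp add: ramp_def max_def min_def)

lemma continuous_ramp: "continuous_on S (ramp h B)"
proof -
  have "continuous_on S (\<lambda>x. B (max 0 (min h x)))"
    using h by (intro continuous_on_compose2[OF B_cont] continuous_intros) auto
  then show ?thesis unfolding ramp_def divide_inverse by (intro continuous_intros)
qed

lemma integrable_ramp_slope: "set_integrable lebesgue {0..h} (\<lambda>x. 1 / h + B' x)"
  using B'_int by (intro set_integral_add) auto

lemma integral_ramp_mult_deriv: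
  assumes \<phi>: "smooth \<phi>"
  shows "(LINT x:{0..h}|lebesgue. ramp h B x * deriv \<phi> x)
    = \<phi> h - (LINT x:{0..h}|lebesgue. (1 / h + B' x) * \<phi> x)"
proof -
  note cont = smooth_continuous_on[OF \<phi>] smooth_continuous_on[OF smooth_deriv[OF \<phi>]] B_cont
  obtain C where C: "\<And>x. x \<in> {0..h} \<Longrightarrow> \<bar>\<phi> x\<bar> \<le> C"
    using continuous_on_Icc_bounded[OF smooth_continuous_on[OF \<phi>]] by blast
  have iB': "set_integrable lebesgue {0..h} (\<lambda>x. B' x * \<phi> x)"
    using B'_int smooth_continuous_on[OF \<phi>] C by (rule set_integrable_mult_bounded)
  have i1: "set_integrable lebesgue {0..h} (\<lambda>x. x / h * deriv \<phi> x)"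
    and i2: "set_integrable lebesgue {0..h} (\<lambda>x. B x * deriv \<phi> x)"
    and i3: "set_integrable lebesgue {0..h} (\<lambda>x. 1 / h * \<phi> x)"
    using h by (auto intro!: absolutely_integrable_continuous_real continuous_intros cont)
  have "(LINT x:{0..h}|lebesgue. ramp h B x * deriv \<phi> x)
      = (LINT x:{0..h}|lebesgue. x / h * deriv \<phi> x + B x * deriv \<phi> x)"
    by (intro set_lebesgue_integral_cong) (auto simp: ramp_cell distrib_right)
  also have "\<dots> = (LINT x:{0..h}|lebesgue. x / h * deriv \<phi> x) + (LINT x:{0..h}|lebesgue. B x * deriv \<phi> x)"
    using i1 i2 by (rule set_integral_add)
  also have "(LINT x:{0..h}|lebesgue. B x * deriv \<phi> x) = - (LINT x:{0..h}|lebesgue. B' x * \<phi> x)"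
    using h B_cont B0 Bh B_weak B'_int \<phi> by (rule integration_by_parts_weak_derivative)
  also have "(LINT x:{0..h}|lebesgue. x / h * deriv \<phi> x) = \<phi> h - (LINT x:{0..h}|lebesgue. 1 / h * \<phi> x)"
  proof -
    have D: "((\<lambda>x. x / h * \<phi> x) has_real_derivative (1 / h * \<phi> x + x / h * deriv \<phi> x)) (at x)" for x
      using h by (auto intro!: derivative_eq_intros smooth_DERIV[OF \<phi>] simp: field_simps)
    have "(LINT x:{0..h}|lebesgue. 1 / h * \<phi> x + x / h * deriv \<phi> x) = \<phi> h"
      using h by (subst set_integral_FTC[OF _ D]) (auto intro!: continuous_intros cont)
    then show ?thesis using set_integral_add(2)[OF i3 i1] by simp
  qed
  also have "\<phi> h - (LINT x:{0..h}|lebesgue. 1 / h * \<phi> x) + - (LINT x:{0..h}|lebesgue. B' x * \<phi> x)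
      = \<phi> h - (LINT x:{0..h}|lebesgue. 1 / h * \<phi> x + B' x * \<phi> x)"
    using set_integral_add(2)[OF i3 iB'] by simp
  finally show ?thesis by (simp add: distrib_right)
qed

text \<open>
  The three pieces of the ramp are integrated separately. The boundary term of the cell at its right end
  cancels against the constant piece to the right, where \<open>\<phi>\<close> vanishes at \<open>b\<close>.
\<close>
lemma has_weak_derivative_ramp:
  assumes t: "a \<le> t" "t + h \<le> b"
  shows "has_weak_derivative a b (\<lambda>x. ramp h B (x - t)) (\<lambda>x. ramp_slope h B' (x - t))"
  unfolding has_weak_derivative_def
proof (intro conjI allI impI)
  have rc: "continuous_on S (\<lambda>x. ramp h B (x - t))" for S
    by (intro continuous_on_compose2[OF continuous_ramp[of UNIV]] continuous_intros) auto
  then show "locally_integrable a b (\<lambda>x. ramp h B (x - t))"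
    unfolding locally_integrable_def by (auto intro: absolutely_integrable_continuous_real)
  have "integrable lebesgue (ramp_slope h B')"
    using integrable_ramp_slope by (simp add: set_integrable_def ramp_slope_def[abs_def])
  then have si: "integrable lebesgue (\<lambda>x. ramp_slope h B' (x - t))"
    using lebesgue_integrable_real_affine_iff[of 1 "ramp_slope h B'" "- t"] by simp
  then show "locally_integrable a b (\<lambda>x. ramp_slope h B' (x - t))"
    unfolding locally_integrable_def set_integrable_def
    by (intro allI impI integrable_mult_indicator) auto
  fix \<phi> assume test: "test_function a b \<phi>"
  note \<phi> = test_function_smooth[OF test]
  have \<phi>0: "\<phi> b = 0" using test unfolding test_function_def by fastforce
  define \<psi> where "\<psi> = (\<lambda>y. \<phi> (t + y))"
  have \<psi>: "smooth \<psi>" unfolding \<psi>_def using smooth_affine[OF \<phi>, of t 1] by simp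
  have \<psi>': "deriv \<psi> y = deriv \<phi> (t + y)" for y
    unfolding \<psi>_def
  proof (rule DERIV_imp_deriv)
    have "((\<lambda>y. \<phi> (t + y)) has_real_derivative deriv \<phi> (t + y) * 1) (at y)"
      by (rule DERIV_chain2[OF smooth_DERIV[OF \<phi>]]) (auto intro!: derivative_eq_intros)
    then show "((\<lambda>y. \<phi> (t + y)) has_real_derivative deriv \<phi> (t + y)) (at y)" by simp
  qed
  have ri: "set_integrable lebesgue {p..q} (\<lambda>x. ramp h B (x - t) * deriv \<phi> x)" for p q
    by (intro absolutely_integrable_continuous_real continuous_on_mult rc
        smooth_continuous_on smooth_deriv \<phi>)
  have "(LINT x:{a<..<b}|lebesgue. ramp h B (x - t) * deriv \<phi> x)
      = (LINT x:{a..t}|lebesgue. ramp h B (x - t) * deriv \<phi> x)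
      + ((LINT x:{t..t + h}|lebesgue. ramp h B (x - t) * deriv \<phi> x)
      + (LINT x:{t + h..b}|lebesgue. ramp h B (x - t) * deriv \<phi> x))"
    using t h ri by (simp add: set_integral_open_interval
        set_integral_combine_Icc(2)[of a t b] set_integral_combine_Icc(2)[of t "t + h" b])
  also have "(LINT x:{a..t}|lebesgue. ramp h B (x - t) * deriv \<phi> x) = (LINT x:{a..t}|lebesgue. 0)"
    by (intro set_lebesgue_integral_cong) (auto simp: ramp_left)
  also have "(LINT x:{t + h..b}|lebesgue. ramp h B (x - t) * deriv \<phi> x) = (LINT x:{t + h..b}|lebesgue. deriv \<phi> x)"
    by (intro set_lebesgue_integral_cong) (auto simp: ramp_right)
  also have "\<dots> = - \<phi> (t + h)"
    using t \<phi>0 by (subst set_integral_FTC[OF _ smooth_DERIV[OF \<phi>]])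
      (auto intro: smooth_continuous_on smooth_deriv \<phi>)
  also have "(LINT x:{t..t + h}|lebesgue. ramp h B (x - t) * deriv \<phi> x)
      = (LINT x:{0..h}|lebesgue. ramp h B x * deriv \<psi> x)"
    using set_integral_translate[of t 0 h "\<lambda>x. ramp h B (x - t) * deriv \<phi> x"] by (simp add: \<psi>')
  also have "\<dots> = \<phi> (t + h) - (LINT x:{0..h}|lebesgue. (1 / h + B' x) * \<psi> x)"
    using integral_ramp_mult_deriv[OF \<psi>] by (simp add: \<psi>_def)
  also have "(LINT x:{0..h}|lebesgue. (1 / h + B' x) * \<psi> x)
      = (LINT x:{t..t + h}|lebesgue. (1 / h + B' (x - t)) * \<phi> x)"
    using set_integral_translate[of t 0 h "\<lambda>x. (1 / h + B' (x - t)) * \<phi> x"] by (simp add: \<psi>_def)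
  also have "\<dots> = (LINT x:{a..b}|lebesgue. ramp_slope h B' (x - t) * \<phi> x)"
    unfolding set_lebesgue_integral_def
    by (intro Bochner_Integration.integral_cong) (use t h in \<open>auto simp: indicator_def ramp_slope_def\<close>)
  finally show "(LINT x:{a<..<b}|lebesgue. ramp h B (x - t) * deriv \<phi> x)
      = - (LINT x:{a<..<b}|lebesgue. ramp_slope h B' (x - t) * \<phi> x)"
    by (simp add: set_integral_open_interval)
qed

end

section \<open>Functions on the mesh as sums of ramps\<close>

text \<open>
  The element of the bubble enriched space with nodal values \<open>c\<close>, up to the constant \<open>c 0\<close>.
  Writing it in terms of increments instead of hat functions makes its derivative diagonal with respect
  to the cells.
\<close>
definition spline :: "nat \<Rightarrow> (real \<Rightarrow> real) \<Rightarrow> (nat \<Rightarrow> real) \<Rightarrow> real \<Rightarrow> real" where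
  "spline n B c x = (\<Sum>i = 1..n. (c i - c (i - 1)) * ramp (mesh_size n) B (x - node n (i - 1)))"

definition spline_slope :: "nat \<Rightarrow> (real \<Rightarrow> real) \<Rightarrow> (nat \<Rightarrow> real) \<Rightarrow> real \<Rightarrow> real" where
  "spline_slope n B' c x = (\<Sum>i = 1..n. (c i - c (i - 1)) * ramp_slope (mesh_size n) B' (x - node n (i - 1)))"

lemma sum_telescope:
  fixes f :: "nat \<Rightarrow> real"
  shows "(\<Sum>i = 1..m. f i - f (i - 1)) = f m - f 0"
  by (induction m) simp_all

text \<open>
  All integrals below are reduced to the reference cell \<open>[0, h]\<close> with this lemma. The
  function is described on the open cells only, as slopes are not determined at the nodes.
\<close>
lemma mesh_integral:
  fixes F :: "real \<Rightarrow> real"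
  assumes n: "n > 0" and G: "\<And>i. i \<in> {1..n} \<Longrightarrow> set_integrable lebesgue {0..mesh_size n} (G i)"
    and F: "\<And>i y. i \<in> {1..n} \<Longrightarrow> 0 < y \<Longrightarrow> y < mesh_size n \<Longrightarrow> F (node n (i - 1) + y) = G i y"
  shows "set_integrable lebesgue {0..1} F"
    and "(LINT x:{0..1}|lebesgue. F x) = (\<Sum>i = 1..n. LINT y:{0..mesh_size n}|lebesgue. G i y)"
    and "\<And>i. i \<in> {1..n} \<Longrightarrow>
      (LINT x:{node n (i - 1)..node n i}|lebesgue. F x) = (LINT y:{0..mesh_size n}|lebesgue. G i y)"
proof -
  have node: "node n i = node n (i - 1) + mesh_size n" if "i \<in> {1..n}" for i
    using that by (cases i) (auto simp: node_def algebra_simps)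
  have h: "mesh_size n > 0" using n by (simp add: mesh_size_def)
  have cell: "set_integrable lebesgue {node n (i - 1)..node n i} F
      \<and> (LINT x:{node n (i - 1)..node n i}|lebesgue. F x) = (LINT y:{0..mesh_size n}|lebesgue. G i y)"
    if i: "i \<in> {1..n}" for i
  proof
    have "set_integrable lebesgue {0<..<mesh_size n} (\<lambda>y. F (node n (i - 1) + y))
        \<longleftrightarrow> set_integrable lebesgue {0<..<mesh_size n} (G i)"
      using F[OF i] by (intro set_integrable_cong) auto
    then show "set_integrable lebesgue {node n (i - 1)..node n i} F"
      using G[OF i] set_integrable_translate[of "node n (i - 1)" 0 "mesh_size n" F]
      by (simp add: node[OF i] set_integrable_open_interval)
    have "(LINT y:{0<..<mesh_size n}|lebesgue. F (node n (i - 1) + y)) = (LINT y:{0<..<mesh_size n}|lebesgue. G i y)"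
      using F[OF i] by (intro set_lebesgue_integral_cong) auto
    then show "(LINT x:{node n (i - 1)..node n i}|lebesgue. F x) = (LINT y:{0..mesh_size n}|lebesgue. G i y)"
      using set_integral_translate[of "node n (i - 1)" 0 "mesh_size n" F]
      by (simp add: node[OF i] set_integral_open_interval)
  qed
  then show "(LINT x:{node n (i - 1)..node n i}|lebesgue. F x) = (LINT y:{0..mesh_size n}|lebesgue. G i y)"
    if "i \<in> {1..n}" for i
    using that by blast
  have "m \<le> n \<Longrightarrow> set_integrable lebesgue {0..node n m} F
      \<and> (LINT x:{0..node n m}|lebesgue. F x) = (\<Sum>i = 1..m. LINT y:{0..mesh_size n}|lebesgue. G i y)" for m
  proof (induction m)
    case 0
    have "(LINT x:{0..0}|lebesgue. F x) = (LINT x:{}|lebesgue. F x)"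
      by (rule set_integral_discrete_difference[of "{0}"]) auto
    moreover have "set_integrable lebesgue {0..0} F \<longleftrightarrow> set_integrable lebesgue {} F"
      by (rule set_integrable_discrete_difference[of "{0}"]) auto
    ultimately show ?case by (simp add: node_def set_lebesgue_integral_def)
  next
    case (Suc m)
    have "0 \<le> node n m" "node n m \<le> node n (Suc m)"
      using h by (simp_all add: node_def mult_right_mono)
    then show ?case
      using Suc cell[of "Suc m"] set_integral_combine_Icc[of 0 "node n m" "node n (Suc m)" F] by simp
  qed
  from this[of n] show "set_integrable lebesgue {0..1} F"
    and "(LINT x:{0..1}|lebesgue. F x) = (\<Sum>i = 1..n. LINT y:{0..mesh_size n}|lebesgue. G i y)"
    using n by (simp_all add: node_def mesh_size_def)
qed

locale mesh_bubble = cell_bubble h B B' for h B B' +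
  fixes n :: nat
  assumes n: "n > 0" and hn: "h = mesh_size n"
begin

lemma node_eq: "node n i = real i * h"
  by (simp add: node_def hn)

lemma bubble_eq: "bubble n B (Suc i) x = B (max 0 (min h (x - node n i)))"
proof -
  have cell: "bubble n B (Suc i) x = (if 0 \<le> x - node n i \<and> x - node n i \<le> h then B (x - node n i) else 0)"
    by (simp add: bubble_def node_eq algebra_simps)
  consider "x - node n i < 0" | "0 \<le> x - node n i \<and> x - node n i \<le> h" | "x - node n i > h"
    by linarith
  then show ?thesis
  proof cases
    case 1
    then have "max 0 (min h (x - node n i)) = 0" by linarith
    then show ?thesis unfolding cell using 1 B0 by simp
  next
    case 2
    then have "max 0 (min h (x - node n i)) = x - node n i" by linarith
    then show ?thesis unfolding cell using 2 by simp
  next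
    case 3
    then have "max 0 (min h (x - node n i)) = h" using h by linarith
    then show ?thesis unfolding cell using 3 Bh by simp
  qed
qed

text \<open>
  Left of the node \<open>x\<^sub>j\<close> the first ramp rises, carrying the bubble of the cell; right of it the second one,
  subtracted, brings the sum back to \<open>0\<close> and carries the next bubble with a minus sign. This
  sign pattern is the reason why the bubbles enter the test space as \<open>B\<^sub>j - B\<^sub>j\<^sub>+\<^sub>1\<close>.
\<close>
lemma hat_plus_bubbles_eq_ramp_diff:
  assumes "j \<ge> 1"
  shows "hat n j x + (bubble n B j x - bubble n B (j + 1) x)
    = ramp h B (x - node n (j - 1)) - ramp h B (x - node n j)"
proof -
  obtain k where j: "j = Suc k" using assms by (cases j) auto
  then have j_pred: "j - 1 = k" by simp
  define y where "y = x - node n j"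
  have y: "x - node n k = y + h" by (simp add: y_def j node_eq algebra_simps)
  have 1: "bubble n B j x = B (max 0 (min h (y + h)))"
    using bubble_eq[of k x] by (simp only: j y)
  have 2: "bubble n B (j + 1) x = B (max 0 (min h y))"
    using bubble_eq[of j x] by (simp add: y_def)
  have 3: "hat n j x = max 0 (min h (y + h)) / h - max 0 (min h y) / h"
    unfolding hat_def y_def[symmetric] hn[symmetric]
    using h by (auto simp: max_def min_def abs_if field_simps)
  show ?thesis
    unfolding 1 2 3 ramp_def y[folded j_pred] y_def[symmetric] by simp
qed

lemma sum_basis_eq_spline:
  assumes "c 0 = 0" "c n = 0"
  shows "(\<lambda>x. \<Sum>j = 1..n - 1. c j * (hat n j x + (bubble n B j x - bubble n B (j + 1) x))) = spline n B c"
proof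
  fix x
  define r where "r = (\<lambda>i. ramp h B (x - node n (i - 1)))"
  \<comment> \<open>Summation by parts; the boundary terms vanish with \<open>c 0\<close> and \<open>c n\<close>.\<close>
  have abel: "(\<Sum>j = 1..m. c j * (r j - r (j + 1))) = (\<Sum>i = 1..m. (c i - c (i - 1)) * r i) - c m * r (Suc m)" for m
  proof (induction m)
    case (Suc m)
    have "(\<Sum>j = 1..Suc m. c j * (r j - r (j + 1)))
        = (\<Sum>j = 1..m. c j * (r j - r (j + 1))) + c (Suc m) * (r (Suc m) - r (Suc (Suc m)))"
      by simp
    also have "\<dots> = ((\<Sum>i = 1..m. (c i - c (i - 1)) * r i) + (c (Suc m) - c m) * r (Suc m))
        - c (Suc m) * r (Suc (Suc m))"
      unfolding Suc.IH by (simp only: left_diff_distrib right_diff_distrib)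
    also have "(\<Sum>i = 1..m. (c i - c (i - 1)) * r i) + (c (Suc m) - c m) * r (Suc m)
        = (\<Sum>i = 1..Suc m. (c i - c (i - 1)) * r i)"
      by simp
    finally show ?case .
  qed (simp add: assms(1))
  have "(\<Sum>j = 1..n - 1. c j * (hat n j x + (bubble n B j x - bubble n B (j + 1) x)))
      = (\<Sum>j = 1..n - 1. c j * (r j - r (j + 1)))"
  proof (intro sum.cong refl)
    fix j assume "j \<in> {1..n - 1}"
    then have "1 \<le> j" by simp
    from hat_plus_bubbles_eq_ramp_diff[OF this, of x]
    show "c j * (hat n j x + (bubble n B j x - bubble n B (j + 1) x)) = c j * (r j - r (j + 1))"
      by (simp only: r_def add_diff_cancel_right')
  qed
  also have "\<dots> = (\<Sum>i = 1..n. (c i - c (i - 1)) * r i)"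
    using n assms(2) unfolding abel by (cases n) simp_all
  finally show "(\<Sum>j = 1..n - 1. c j * (hat n j x + (bubble n B j x - bubble n B (j + 1) x))) = spline n B c x"
    by (simp add: spline_def r_def hn)
qed

lemma spline_on_cell:
  assumes i: "i \<in> {1..n}" and y: "0 \<le> y" "y \<le> h"
  shows "spline n B c (node n (i - 1) + y) = c (i - 1) - c 0 + (c i - c (i - 1)) * (y / h + B y)"
proof -
  have "(\<Sum>k = 1..m. (c k - c (k - 1)) * ramp h B (node n (i - 1) + y - node n (k - 1)))
      = (if m < i then c m - c 0 else c (i - 1) - c 0 + (c i - c (i - 1)) * (y / h + B y))" for m
  proof (induction m)
    case (Suc m)
    consider "Suc m < i" | "Suc m = i" | "Suc m > i" by linarith
    then show ?case
    proof cases
      case 1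
      then have "real m + 1 \<le> real (i - 1)" by linarith
      then have "(real m + 1) * h \<le> real (i - 1) * h" using h by (intro mult_right_mono) auto
      then have "ramp h B (node n (i - 1) + y - node n m) = 1"
        using y by (intro ramp_right) (simp add: node_eq algebra_simps)
      then show ?thesis using 1 Suc by simp
    next
      case 2
      then have i_eq: "i = Suc m" by simp
      show ?thesis using Suc y unfolding i_eq by (simp add: ramp_cell)
    next
      case 3
      then have "real (i - 1) + 1 \<le> real m" using i by auto
      then have "(real (i - 1) + 1) * h \<le> real m * h" using h by (intro mult_right_mono) auto
      then have "ramp h B (node n (i - 1) + y - node n m) = 0"
        using y by (intro ramp_left) (simp add: node_eq algebra_simps)
      then show ?thesis using 3 Suc by simp
    qed
  qed (use i in simp)
  from this[of n] show ?thesis using i by (simp add: spline_def hn)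
qed

lemma spline_slope_on_cell:
  assumes i: "i \<in> {1..n}" and y: "0 < y" "y < h"
  shows "spline_slope n B' c (node n (i - 1) + y) = (c i - c (i - 1)) * (1 / h + B' y)"
proof -
  have "(\<Sum>k = 1..n. (c k - c (k - 1)) * ramp_slope h B' (node n (i - 1) + y - node n (k - 1)))
      = (\<Sum>k = 1..n. if k = i then (c i - c (i - 1)) * (1 / h + B' y) else 0)"
  proof (intro sum.cong refl)
    fix k assume k: "k \<in> {1..n}"
    consider "k < i" | "k = i" | "k > i" by linarith
    then show "(c k - c (k - 1)) * ramp_slope h B' (node n (i - 1) + y - node n (k - 1))
        = (if k = i then (c i - c (i - 1)) * (1 / h + B' y) else 0)"
    proof cases
      case 1
      then have "real (k - 1) + 1 \<le> real (i - 1)" using k by auto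
      then have "(real (k - 1) + 1) * h \<le> real (i - 1) * h" using h by (intro mult_right_mono) auto
      then have "node n (i - 1) + y - node n (k - 1) > h"
        using y by (simp add: node_eq algebra_simps)
      then show ?thesis using 1 by (simp add: ramp_slope_def)
    next
      case 2
      then show ?thesis using y by (simp add: ramp_slope_def)
    next
      case 3
      then have "real (i - 1) + 1 \<le> real (k - 1)" using i by auto
      then have "(real (i - 1) + 1) * h \<le> real (k - 1) * h" using h by (intro mult_right_mono) auto
      then have "node n (i - 1) + y - node n (k - 1) < 0"
        using y by (simp add: node_eq algebra_simps)
      then show ?thesis using 3 by (simp add: ramp_slope_def)
    qed
  qed
  then show ?thesis using i by (simp add: spline_slope_def hn)
qed

lemma has_weak_derivative_spline: "has_weak_derivative 0 1 (spline n B c) (spline_slope n B' c)"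
proof -
  have "has_weak_derivative 0 1 (\<lambda>x. ramp h B (x - node n (i - 1))) (\<lambda>x. ramp_slope h B' (x - node n (i - 1)))"
    if i: "i \<in> {1..n}" for i
  proof (rule has_weak_derivative_ramp)
    show "0 \<le> node n (i - 1)" using h by (simp add: node_eq)
    have "real i * h \<le> real n * h" using i h by (intro mult_right_mono) auto
    moreover have "node n (i - 1) + h = real i * h" using i by (cases i) (auto simp: node_eq algebra_simps)
    moreover have "real n * h = 1" using n by (simp add: hn mesh_size_def)
    ultimately show "node n (i - 1) + h \<le> 1" by simp
  qed
  then show ?thesis
    unfolding spline_def[abs_def] spline_slope_def[abs_def] hn[symmetric]
    by (intro has_weak_derivative_sum has_weak_derivative_mult_right) auto
qed

lemma AE_weak_deriv_spline:
  "AE x in lebesgue. x \<in> {0..1} \<longrightarrow> weak_deriv 0 1 (spline n B c) x = spline_slope n B' c x"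
proof -
  have "AE x in lebesgue. x \<notin> {0, 1::real}"
    by (intro AE_not_in) (simp flip: negligible_iff_null_sets)
  with AE_weak_deriv_eq[OF has_weak_derivative_spline, of c] show ?thesis
    by eventually_elim auto
qed

text \<open>
  The bubble contributes nothing, since it vanishes at both ends of the cell: integrate by parts
  against the constant \<open>1\<close>.
\<close>
lemma integral_bubble_slope: "(LINT y:{0..h}|lebesgue. 1 / h + B' y) = 1"
proof -
  have "(LINT y:{0..h}|lebesgue. B' y) = 0"
    using integration_by_parts_weak_derivative[OF h B_cont B0 Bh B_weak B'_int smooth_const[of 1]] by simp
  moreover have "(LINT y:{0..h}|lebesgue. 1 / h + B' y) = (LINT y:{0..h}|lebesgue. 1 / h) + (LINT y:{0..h}|lebesgue. B' y)"
    using B'_int by (intro set_integral_add) auto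
  ultimately show ?thesis using h by (simp add: set_lebesgue_integral_def)
qed

text \<open>
  In the square of \<open>1/h + B'\<close> the mixed term integrates to \<open>0\<close>. It is split off as a multiple of
  \<open>1/h + B'\<close>, whose integral is already known to be \<open>1\<close>.
\<close>
lemma energy_norm_spline:
  assumes B'2: "set_integrable lebesgue {0..h} (\<lambda>y. (B' y)\<^sup>2)"
    and b2: "(LINT y:{0..h}|lebesgue. (B' y)\<^sup>2) = b\<^sub>2 / h"
  shows "(energy_norm (spline n B c))\<^sup>2 = (1 + b\<^sub>2) / h * (\<Sum>i = 1..n. (c i - c (i - 1))\<^sup>2)"
proof -
  have sq: "(1 / h + B' y)\<^sup>2 = (2 / h * (1 / h + B' y) - 1 / h ^ 2) + (B' y)\<^sup>2" for y
    by (simp add: power2_eq_square algebra_simps)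
  have i0: "set_integrable lebesgue {0..h} (\<lambda>y. 2 / h * (1 / h + B' y) - 1 / h ^ 2)"
    using integrable_ramp_slope by (intro set_integral_diff set_integrable_mult_right) auto
  have i1: "set_integrable lebesgue {0..h} (\<lambda>y. (1 / h + B' y)\<^sup>2)"
    unfolding sq using i0 B'2 by (rule set_integral_add)
  have "(LINT y:{0..h}|lebesgue. (1 / h + B' y)\<^sup>2) = (LINT y:{0..h}|lebesgue. 2 / h * (1 / h + B' y) - 1 / h ^ 2) + b\<^sub>2 / h"
    unfolding sq using set_integral_add(2)[OF i0 B'2] b2 by simp
  also have "(LINT y:{0..h}|lebesgue. 2 / h * (1 / h + B' y) - 1 / h ^ 2)
      = 2 / h * (LINT y:{0..h}|lebesgue. 1 / h + B' y) - (LINT y:{0..h}|lebesgue. 1 / h ^ 2)"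
    unfolding set_integral_mult_right[symmetric]
    by (intro set_integral_diff(2) set_integrable_mult_right integrable_ramp_slope) auto
  also have "\<dots> = 1 / h"
    using h by (simp add: integral_bubble_slope) (simp add: set_lebesgue_integral_def power2_eq_square field_simps)
  finally have Q: "(LINT y:{0..h}|lebesgue. (1 / h + B' y)\<^sup>2) = (1 + b\<^sub>2) / h"
    by (simp add: add_divide_distrib)
  have G: "set_integrable lebesgue {0..mesh_size n} (\<lambda>y. (c i - c (i - 1))\<^sup>2 * (1 / h + B' y)\<^sup>2)" for i
    using i1 by (simp add: hn)
  have F: "(spline_slope n B' c (node n (i - 1) + y))\<^sup>2 = (c i - c (i - 1))\<^sup>2 * (1 / h + B' y)\<^sup>2"
    if "i \<in> {1..n}" "0 < y" "y < mesh_size n" for i y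
    using spline_slope_on_cell[of i y c] that by (simp add: hn power_mult_distrib)
  have "(LINT x:{0..1}|lebesgue. (weak_deriv 0 1 (spline n B c) x)\<^sup>2) = (LINT x:{0..1}|lebesgue. (spline_slope n B' c x)\<^sup>2)"
    by (rule set_integral_lebesgue_cong_AE[OF mesh_integral(1)[OF n G F]], assumption+)
      (use AE_weak_deriv_spline[of c] in \<open>auto elim!: eventually_mono\<close>)
  also have "\<dots> = (\<Sum>i = 1..n. LINT y:{0..mesh_size n}|lebesgue. (c i - c (i - 1))\<^sup>2 * (1 / h + B' y)\<^sup>2)"
    by (rule mesh_integral(2)[OF n G F])
  also have "\<dots> = (1 + b\<^sub>2) / h * (\<Sum>i = 1..n. (c i - c (i - 1))\<^sup>2)"
    unfolding hn[symmetric] set_integral_mult_right Q by (simp add: sum_distrib_left mult.commute)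
  finally have "(LINT x:{0..1}|lebesgue. (weak_deriv 0 1 (spline n B c) x)\<^sup>2)
      = (1 + b\<^sub>2) / h * (\<Sum>i = 1..n. (c i - c (i - 1))\<^sup>2)" .
  moreover have "(LINT x:{0..1}|lebesgue. (weak_deriv 0 1 (spline n B c) x)\<^sup>2) \<ge> 0"
    by (simp add: set_lebesgue_integral_def)
  ultimately show ?thesis by (simp add: energy_norm_def)
qed

end

section \<open>The bilinear form on the discrete spaces\<close>

text \<open>
  The zero bubble turns every fact about the test space into one about the trial space.
\<close>
lemma mesh_bubble_zero: "n > 0 \<Longrightarrow> mesh_bubble (mesh_size n) (\<lambda>x. 0) (\<lambda>x. 0) n"
  by unfold_locales (auto simp: mesh_size_def has_weak_derivative_zero)

context mesh_bubble
begin

lemma integral_cell_profile: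
  "set_integrable lebesgue {0..h} (\<lambda>y. p + q * (y / h + B y))"
  "(LINT y:{0..h}|lebesgue. p + q * (y / h + B y)) = h * p + q * (h / 2 + (LINT y:{0..h}|lebesgue. B y))"
proof -
  have iB: "set_integrable lebesgue {0..h} B"
    using B_cont by (rule absolutely_integrable_continuous_real)
  have ix: "set_integrable lebesgue {0..h} (\<lambda>y. y / h)"
    using h by (intro absolutely_integrable_continuous_real continuous_intros) auto
  have ip: "set_integrable lebesgue {0..h} (\<lambda>y. p)" by simp
  have iq: "set_integrable lebesgue {0..h} (\<lambda>y. q * (y / h + B y))"
    using ix iB by (intro set_integrable_mult_right set_integral_add)
  show "set_integrable lebesgue {0..h} (\<lambda>y. p + q * (y / h + B y))"
    using ip iq by (rule set_integral_add)
  have D: "((\<lambda>y. y\<^sup>2 / (2 * h)) has_real_derivative y / h) (at y)" for y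
    using h by (auto intro!: derivative_eq_intros simp: field_simps)
  have "(LINT y:{0..h}|lebesgue. y / h) = h / 2"
    using h by (subst set_integral_FTC[OF _ D]) (auto intro!: continuous_intros simp: power2_eq_square)
  moreover have "(LINT y:{0..h}|lebesgue. p) = h * p"
    using h by (simp add: set_lebesgue_integral_def)
  ultimately show "(LINT y:{0..h}|lebesgue. p + q * (y / h + B y)) = h * p + q * (h / 2 + (LINT y:{0..h}|lebesgue. B y))"
    using set_integral_add(2)[OF ip iq] set_integral_add(2)[OF ix iB] by simp
qed

lemma
  assumes c0: "c 0 = 0"
  shows integral_spline_cell: "i \<in> {1..n} \<Longrightarrow> (LINT x:{node n (i - 1)..node n i}|lebesgue. spline n B c x)
      = h * c (i - 1) + (c i - c (i - 1)) * (h / 2 + (LINT y:{0..h}|lebesgue. B y))"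
    and integral_spline: "(LINT x:{0..1}|lebesgue. spline n B c x)
      = (\<Sum>i = 1..n. h * c (i - 1) + (c i - c (i - 1)) * (h / 2 + (LINT y:{0..h}|lebesgue. B y)))"
proof -
  have G: "set_integrable lebesgue {0..mesh_size n} (\<lambda>y. c (i - 1) + (c i - c (i - 1)) * (y / h + B y))" for i
    using integral_cell_profile(1) by (simp add: hn)
  have F: "spline n B c (node n (i - 1) + y) = c (i - 1) + (c i - c (i - 1)) * (y / h + B y)"
    if "i \<in> {1..n}" "0 < y" "y < mesh_size n" for i y
    using spline_on_cell[of i y c] that c0 by (simp add: hn)
  show "(LINT x:{node n (i - 1)..node n i}|lebesgue. spline n B c x)
      = h * c (i - 1) + (c i - c (i - 1)) * (h / 2 + (LINT y:{0..h}|lebesgue. B y))" if "i \<in> {1..n}"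
    using mesh_integral(3)[OF n G F that] integral_cell_profile(2) by (simp add: hn)
  show "(LINT x:{0..1}|lebesgue. spline n B c x)
      = (\<Sum>i = 1..n. h * c (i - 1) + (c i - c (i - 1)) * (h / 2 + (LINT y:{0..h}|lebesgue. B y)))"
    using mesh_integral(2)[OF n G F] integral_cell_profile(2) by (simp add: hn)
qed

text \<open>
  On a cell the slope of the trial function is a constant, so the diffusive term sees only the increment of
  \<open>v\<close> and the convective term only its integral over the cell; this is where the mean of the bubble enters.
\<close>
lemma bform_spline:
  assumes c0: "c 0 = 0"
  shows "bform \<epsilon> (spline n B c) (spline n (\<lambda>x. 0) a) =
    (\<Sum>i = 1..n. (a i - a (i - 1)) / h *
      (\<epsilon> * (c i - c (i - 1)) + h * c (i - 1) + (c i - c (i - 1)) * (h / 2 + (LINT y:{0..h}|lebesgue. B y))))"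
proof -
  interpret Z: mesh_bubble h "\<lambda>x. 0" "\<lambda>x. 0" n
    using mesh_bubble_zero[OF n] by (simp add: hn)
  have u': "AE x in lebesgue. x \<in> {0..1} \<longrightarrow>
      weak_deriv 0 1 (spline n (\<lambda>x. 0) a) x = spline_slope n (\<lambda>x. 0) a x"
    by (rule Z.AE_weak_deriv_spline)
  have u'_cell: "spline_slope n (\<lambda>x. 0) a (node n (i - 1) + y) = (a i - a (i - 1)) / h"
    if "i \<in> {1..n}" "0 < y" "y < mesh_size n" for i y
    using Z.spline_slope_on_cell[of i y a] that by (simp add: hn)
  have G1: "set_integrable lebesgue {0..mesh_size n} (\<lambda>y. (a i - a (i - 1)) / h * ((c i - c (i - 1)) * (1 / h + B' y)))" for i
    unfolding hn[symmetric] by (intro set_integrable_mult_right integrable_ramp_slope)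
  have F1: "spline_slope n (\<lambda>x. 0) a (node n (i - 1) + y) * spline_slope n B' c (node n (i - 1) + y)
      = (a i - a (i - 1)) / h * ((c i - c (i - 1)) * (1 / h + B' y))"
    if "i \<in> {1..n}" "0 < y" "y < mesh_size n" for i y
    using spline_slope_on_cell[of i y c] u'_cell[of i y] that by (simp add: hn)
  have "(LINT x:{0..1}|lebesgue. weak_deriv 0 1 (spline n (\<lambda>x. 0) a) x * weak_deriv 0 1 (spline n B c) x)
      = (LINT x:{0..1}|lebesgue. spline_slope n (\<lambda>x. 0) a x * spline_slope n B' c x)"
  proof (rule set_integral_lebesgue_cong_AE[OF mesh_integral(1)[OF n G1 F1]])
    show "AE x in lebesgue. x \<in> {0..1} \<longrightarrow>
        weak_deriv 0 1 (spline n (\<lambda>x. 0) a) x * weak_deriv 0 1 (spline n B c) x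
        = spline_slope n (\<lambda>x. 0) a x * spline_slope n B' c x"
      using u' AE_weak_deriv_spline[of c] by eventually_elim simp
  qed
  also have "\<dots> = (\<Sum>i = 1..n. LINT y:{0..mesh_size n}|lebesgue. (a i - a (i - 1)) / h * ((c i - c (i - 1)) * (1 / h + B' y)))"
    by (rule mesh_integral(2)[OF n G1 F1])
  also have "\<dots> = (\<Sum>i = 1..n. (a i - a (i - 1)) / h * (c i - c (i - 1)))"
    unfolding hn[symmetric] set_integral_mult_right integral_bubble_slope by simp
  finally have 1: "(LINT x:{0..1}|lebesgue. weak_deriv 0 1 (spline n (\<lambda>x. 0) a) x * weak_deriv 0 1 (spline n B c) x)
      = (\<Sum>i = 1..n. (a i - a (i - 1)) / h * (c i - c (i - 1)))" .
  have G2: "set_integrable lebesgue {0..mesh_size n} (\<lambda>y. (a i - a (i - 1)) / h * (c (i - 1) + (c i - c (i - 1)) * (y / h + B y)))" for i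
    unfolding hn[symmetric] by (intro set_integrable_mult_right integral_cell_profile(1))
  have F2: "spline_slope n (\<lambda>x. 0) a (node n (i - 1) + y) * spline n B c (node n (i - 1) + y)
      = (a i - a (i - 1)) / h * (c (i - 1) + (c i - c (i - 1)) * (y / h + B y))"
    if "i \<in> {1..n}" "0 < y" "y < mesh_size n" for i y
    using spline_on_cell[of i y c] u'_cell[of i y] that c0 by (simp add: hn)
  have "(LINT x:{0..1}|lebesgue. weak_deriv 0 1 (spline n (\<lambda>x. 0) a) x * spline n B c x)
      = (LINT x:{0..1}|lebesgue. spline_slope n (\<lambda>x. 0) a x * spline n B c x)"
  proof (rule set_integral_lebesgue_cong_AE[OF mesh_integral(1)[OF n G2 F2]])
    show "AE x in lebesgue. x \<in> {0..1} \<longrightarrow>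
        weak_deriv 0 1 (spline n (\<lambda>x. 0) a) x * spline n B c x
        = spline_slope n (\<lambda>x. 0) a x * spline n B c x"
      using u' by eventually_elim simp
  qed
  also have "\<dots> = (\<Sum>i = 1..n. LINT y:{0..mesh_size n}|lebesgue.
      (a i - a (i - 1)) / h * (c (i - 1) + (c i - c (i - 1)) * (y / h + B y)))"
    by (rule mesh_integral(2)[OF n G2 F2])
  also have "\<dots> = (\<Sum>i = 1..n. (a i - a (i - 1)) / h *
      (h * c (i - 1) + (c i - c (i - 1)) * (h / 2 + (LINT y:{0..h}|lebesgue. B y))))"
    unfolding hn[symmetric] set_integral_mult_right integral_cell_profile(2) ..
  finally have 2: "(LINT x:{0..1}|lebesgue. weak_deriv 0 1 (spline n (\<lambda>x. 0) a) x * spline n B c x)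
      = (\<Sum>i = 1..n. (a i - a (i - 1)) / h *
      (h * c (i - 1) + (c i - c (i - 1)) * (h / 2 + (LINT y:{0..h}|lebesgue. B y))))" .
  show ?thesis
    unfolding bform_def 1 2 sum_distrib_left sum.distrib[symmetric]
    by (intro sum.cong refl) (simp only: distrib_left add.assoc mult.left_commute[of \<epsilon>])
qed

end

text \<open>
  The increments of such \<open>c\<close> are precisely the vectors in \<open>\<real>\<^sup>n\<close> with sum \<open>0\<close>, which is the space over which
  the supremum will be taken.
\<close>
lemma test_space_eq_splines:
  assumes "mesh_bubble (mesh_size n) B B' n"
  shows "test_space n B = spline n B ` {c. c 0 = 0 \<and> c n = 0}"
proof -
  interpret mesh_bubble "mesh_size n" B B' n by fact
  let ?v = "\<lambda>c x. \<Sum>j = 1..n - 1. c j * (hat n j x + (bubble n B j x - bubble n B (j + 1) x))"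
  have "?v c \<in> spline n B ` {c. c 0 = 0 \<and> c n = 0}" for c :: "nat \<Rightarrow> real"
  proof -
    define c' where "c' = (\<lambda>j. if j \<in> {1..n - 1} then c j else 0)"
    have "?v c = ?v c'" by (auto simp: c'_def intro!: sum.cong)
    also have "\<dots> = spline n B c'" using n by (intro sum_basis_eq_spline) (auto simp: c'_def)
    finally show ?thesis using n by (auto simp: c'_def)
  qed
  moreover have "spline n B c = ?v c" if "c 0 = 0" "c n = 0" for c
    using sum_basis_eq_spline[OF that] by simp
  ultimately show ?thesis unfolding test_space_def by fast
qed

lemma trial_space_eq_splines:
  assumes n: "n > 0"
  shows "trial_space n = spline n (\<lambda>x. 0) ` {c. c 0 = 0 \<and> c n = 0}"
proof -
  have "trial_space n = test_space n (\<lambda>x. 0)"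
    unfolding trial_space_eq_span_hat[OF n] test_space_def by (simp add: bubble_def)
  then show ?thesis using test_space_eq_splines[OF mesh_bubble_zero[OF n]] by simp
qed

text \<open>
  Discrete product rule. It turns the convective term into one that is linear in the increments of \<open>v\<close>,
  and with \<open>a = c\<close> it shows that increments and averages are orthogonal.
\<close>
lemma sum_increments_mult_averages:
  fixes a c :: "nat \<Rightarrow> real"
  shows "(\<Sum>i = 1..n. (a i - a (i - 1)) * ((c i + c (i - 1)) / 2)) + (\<Sum>i = 1..n. (c i - c (i - 1)) * ((a i + a (i - 1)) / 2))
    = a n * c n - a 0 * c 0"
proof -
  have "(\<Sum>i = 1..n. (a i - a (i - 1)) * ((c i + c (i - 1)) / 2)) + (\<Sum>i = 1..n. (c i - c (i - 1)) * ((a i + a (i - 1)) / 2))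
      = (\<Sum>i = 1..n. a i * c i - a (i - 1) * c (i - 1))"
    unfolding sum.distrib[symmetric] by (intro sum.cong refl) (simp add: field_simps)
  then show ?thesis using sum_telescope[of "\<lambda>i. a i * c i" n] by simp
qed

section \<open>The extremal problem\<close>

text \<open>
  The seminorm is a variance: the mean of the squared cell averages minus the square of their mean. In
  particular the radicand in its definition is not negative, so squaring undoes the root.
\<close>
lemma (in mesh_bubble) star_seminorm_spline:
  assumes B: "(LINT y:{0..h}|lebesgue. B y) = 0" and c0: "c 0 = 0"
    and m: "m = (\<lambda>i. (c i + c (i - 1)) / 2)" and mb: "mb = (\<Sum>i = 1..n. m i) / real n"
  shows "(star_seminorm n (spline n B c))\<^sup>2 = h * (\<Sum>i = 1..n. (m i - mb)\<^sup>2)"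
proof -
  have nh: "1 / real n = h" by (simp add: hn mesh_size_def)
  have cell: "h * c (i - 1) + (c i - c (i - 1)) * (h / 2) = h * m i" for i
    by (simp add: m field_simps)
  have "(\<Sum>i = 1..n. (1 / h * (LINT x:{node n (i - 1)..node n i}|lebesgue. spline n B c x))\<^sup>2) = (\<Sum>i = 1..n. (m i)\<^sup>2)"
  proof (intro sum.cong refl)
    fix i assume "i \<in> {1..n}"
    from integral_spline_cell[of c, OF c0 this]
    have "(LINT x:{node n (i - 1)..node n i}|lebesgue. spline n B c x) = h * m i"
      by (simp only: B cell add_0_right)
    then show "(1 / h * (LINT x:{node n (i - 1)..node n i}|lebesgue. spline n B c x))\<^sup>2 = (m i)\<^sup>2"
      using h by simp
  qed
  moreover have "(LINT x:{0..1}|lebesgue. spline n B c x) = mb"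
  proof -
    have "(LINT x:{0..1}|lebesgue. spline n B c x) = (\<Sum>i = 1..n. h * m i)"
      by (simp only: integral_spline[of c, OF c0] B cell add_0_right)
    also have "\<dots> = h * (\<Sum>i = 1..n. m i)" by (simp only: sum_distrib_left)
    finally show ?thesis by (simp add: mb nh[symmetric])
  qed
  ultimately have "star_seminorm n (spline n B c) = sqrt (h * (\<Sum>i = 1..n. (m i)\<^sup>2) - mb\<^sup>2)"
    by (simp only: star_seminorm_def hn[symmetric] nh)
  also have "h * (\<Sum>i = 1..n. (m i)\<^sup>2) - mb\<^sup>2 = h * (\<Sum>i = 1..n. (m i - mb)\<^sup>2)"
  proof -
    have "(\<Sum>i = 1..n. (m i - mb)\<^sup>2) = (\<Sum>i = 1..n. (m i)\<^sup>2) - 2 * mb * (\<Sum>i = 1..n. m i) + real n * mb\<^sup>2"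
      by (simp add: power2_diff sum.distrib sum_subtractf sum_distrib_left mult.commute mult.left_commute)
    also have "(\<Sum>i = 1..n. m i) = real n * mb" using n by (simp add: mb)
    finally show ?thesis using n by (simp add: nh[symmetric] power2_eq_square field_simps)
  qed
  finally show ?thesis using h by (simp add: sum_nonneg)
qed

lemma energy_norm_nonneg: "energy_norm v \<ge> 0"
  by (simp add: energy_norm_def set_lebesgue_integral_def)

theorem theorem5p1:
  fixes \<epsilon> h b\<^sub>1 b\<^sub>2 :: real and n :: nat and B B' :: "real \<Rightarrow> real"
  assumes "\<epsilon> > 0" and "n \<ge> 2" and "h = mesh_size n"
    and "continuous_on {0..h} B"
    and "has_weak_derivative 0 h B B'" and "square_integrable_on B' {0<..<h}"
    and "B 0 = 0" and "B h = 0"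
    and "(LINT x:{0..h}|lebesgue. B x) = b\<^sub>1 * h" and "b\<^sub>1 > 0"
    and "(LINT x:{0..h}|lebesgue. (B' x)\<^sup>2) = b\<^sub>2 / h" and "b\<^sub>2 > 0"
  shows "\<forall>u\<in>trial_space n.
    (discrete_optimal_norm \<epsilon> n B u)\<^sup>2 =
      ereal ((\<epsilon> + h * b\<^sub>1)\<^sup>2 / (1 + b\<^sub>2) * (energy_norm u)\<^sup>2 + 1 / (1 + b\<^sub>2) * (star_seminorm n u)\<^sup>2)"
proof
  fix u assume u: "u \<in> trial_space n"
  have n: "n > 0" and h: "h > 0" using assms(2,3) by (auto simp: mesh_size_def)
  have B'2: "set_integrable lebesgue {0..h} (\<lambda>y. (B' y)\<^sup>2)"
    using assms(6) by (simp add: square_integrable_on_def set_integrable_open_interval)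
  have "set_integrable lebesgue {0<..<h} B'"
  proof (rule set_integrable_bound)
    show "set_integrable lebesgue {0<..<h} (\<lambda>y. 1 + (B' y)\<^sup>2)"
      using assms(6) by (intro set_integral_add) (auto simp: square_integrable_on_def set_integrable_open_interval)
    show "set_borel_measurable lebesgue {0<..<h} B'"
      using assms(6) by (simp add: square_integrable_on_def)
    \<comment> \<open>On a bounded interval square integrable functions are integrable.\<close>
    have "\<bar>y\<bar> \<le> 1 + y\<^sup>2" for y :: real
      using sum_power2_ge_zero[of "\<bar>y\<bar> - 1" y] zero_le_power2[of "\<bar>y\<bar> - 1"]
      by (simp add: power2_diff)
    then show "AE y in lebesgue. y \<in> {0<..<h} \<longrightarrow> norm (B' y) \<le> norm (1 + (B' y)\<^sup>2)"
      by (auto simp: add_nonneg_nonneg)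
  qed
  then have B'1: "set_integrable lebesgue {0..h} B'" by (simp add: set_integrable_open_interval)
  interpret mesh_bubble h B B' n
    using h n assms B'1 by unfold_locales auto
  have zero: "mesh_bubble h (\<lambda>x. 0) (\<lambda>x. 0) n"
    using mesh_bubble_zero[OF n] by (simp add: hn)
  interpret Z: mesh_bubble h "\<lambda>x. 0" "\<lambda>x. 0" n by (rule zero)
  obtain a where a: "a 0 = 0" "a n = 0" and u_eq: "u = spline n (\<lambda>x. 0) a"
    using u trial_space_eq_splines[OF n] by auto
  define m where "m = (\<lambda>i. (a i + a (i - 1)) / 2)"
  define mb where "mb = (\<Sum>i = 1..n. m i) / real n"
  \<comment> \<open>\<open>g\<close> represents \<open>b(\<cdot>, u)\<close> as a linear form in the increments, normalised to have sum \<open>0\<close>.\<close>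
  define g where "g = (\<lambda>i. (\<epsilon> + h * b\<^sub>1) / h * (a i - a (i - 1)) - (m i - mb))"
  define G where "G = (\<Sum>i = 1..n. (g i)\<^sup>2)"
  define D where "D = (\<lambda>c :: nat \<Rightarrow> real. \<Sum>i = 1..n. (c i - c (i - 1))\<^sup>2)"
  define R where "R = sqrt (h / (1 + b\<^sub>2) * G)"
  have G0: "G \<ge> 0" and D0: "D c \<ge> 0" for c by (simp_all add: G_def D_def sum_nonneg)
  have b2: "1 + b\<^sub>2 > 0" using assms(12) by simp
  have energy: "energy_norm (spline n B c) = sqrt ((1 + b\<^sub>2) / h * D c)" for c
    using energy_norm_spline[OF B'2 assms(11), of c] energy_norm_nonneg[of "spline n B c"]
    by (simp add: D_def real_sqrt_unique)
  have b: "bform \<epsilon> (spline n B c) u = (\<Sum>i = 1..n. (c i - c (i - 1)) * g i)"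
    if c: "c 0 = 0" "c n = 0" for c
  proof -
    have regroup: "k * (d * e) + (- (d * p) + q * d) = d * (k * e - (p - q))" for d e k p q :: real
      by (simp add: algebra_simps)
    have "bform \<epsilon> (spline n B c) u = (\<Sum>i = 1..n. (\<epsilon> + h * b\<^sub>1) / h * ((c i - c (i - 1)) * (a i - a (i - 1)))
        + (a i - a (i - 1)) * ((c i + c (i - 1)) / 2))"
      unfolding u_eq bform_spline[of c, OF c(1)] assms(9)
      by (intro sum.cong refl) (use h in \<open>simp add: field_simps\<close>)
    also have "\<dots> = (\<epsilon> + h * b\<^sub>1) / h * (\<Sum>i = 1..n. (c i - c (i - 1)) * (a i - a (i - 1)))
        + (\<Sum>i = 1..n. (a i - a (i - 1)) * ((c i + c (i - 1)) / 2))"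
      by (simp only: sum.distrib sum_distrib_left)
    also have "(\<Sum>i = 1..n. (a i - a (i - 1)) * ((c i + c (i - 1)) / 2)) = - (\<Sum>i = 1..n. (c i - c (i - 1)) * m i)"
      using sum_increments_mult_averages[of a c n] a c by (simp add: m_def)
    \<comment> \<open>The mean \<open>mb\<close> may be inserted because the increments of \<open>c\<close> have sum \<open>0\<close>.\<close>
    also have "\<dots> = - (\<Sum>i = 1..n. (c i - c (i - 1)) * m i) + mb * (\<Sum>i = 1..n. c i - c (i - 1))"
      using c sum_telescope[of c n] by simp
    also have "(\<epsilon> + h * b\<^sub>1) / h * (\<Sum>i = 1..n. (c i - c (i - 1)) * (a i - a (i - 1)))
        + (- (\<Sum>i = 1..n. (c i - c (i - 1)) * m i) + mb * (\<Sum>i = 1..n. c i - c (i - 1)))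
        = (\<Sum>i = 1..n. (c i - c (i - 1)) * g i)"
      unfolding sum_distrib_left sum_negf[symmetric] sum.distrib[symmetric] g_def
      by (intro sum.cong refl regroup)
    finally show ?thesis .
  qed
  have scale: "sqrt (D c) * sqrt G / sqrt ((1 + b\<^sub>2) / h * D c) = R" if "D c \<noteq> 0" for c
    using that h b2 by (simp add: R_def real_sqrt_mult real_sqrt_divide)
  have upper: "bform \<epsilon> (spline n B c) u / energy_norm (spline n B c) \<le> R" if c: "c 0 = 0" "c n = 0" for c
  proof (cases "D c = 0")
    case True
    then show ?thesis using h b2 G0 by (simp add: energy R_def)
  next
    case False
    have "(\<Sum>i = 1..n. (c i - c (i - 1)) * g i)\<^sup>2 \<le> D c * G"
      unfolding D_def G_def by (rule Cauchy_Schwarz_ineq_sum)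
    then have "\<bar>\<Sum>i = 1..n. (c i - c (i - 1)) * g i\<bar> \<le> sqrt (D c) * sqrt G"
      using real_sqrt_le_mono[of _ "D c * G"] by (fastforce simp: real_sqrt_mult)
    then have "bform \<epsilon> (spline n B c) u \<le> sqrt (D c) * sqrt G"
      unfolding b[OF c] by linarith
    then have "bform \<epsilon> (spline n B c) u / energy_norm (spline n B c)
        \<le> sqrt (D c) * sqrt G / sqrt ((1 + b\<^sub>2) / h * D c)"
      unfolding energy using h b2 D0 by (intro divide_right_mono) auto
    then show ?thesis using scale[OF False] by simp
  qed
  have nonzero: "spline n B c \<noteq> (\<lambda>x. 0)" if "D c \<noteq> 0" for c
  proof
    assume "spline n B c = (\<lambda>x. 0)"
    then have "spline n B c = spline n B (\<lambda>i. 0)" by (simp add: spline_def fun_eq_iff)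
    then have "sqrt ((1 + b\<^sub>2) / h * D c) = sqrt ((1 + b\<^sub>2) / h * D (\<lambda>i. 0))"
      by (simp only: energy[symmetric])
    then show False using that h b2 by (simp add: D_def)
  qed
  have sum_a: "(\<Sum>i = 1..n. a i - a (i - 1)) = 0" using a sum_telescope[of a n] by simp
  have sum_m: "(\<Sum>i = 1..n. m i - mb) = 0" using n by (simp add: sum_subtractf mb_def)
  have attained: "\<exists>c. c 0 = 0 \<and> c n = 0 \<and> D c \<noteq> 0 \<and>
      bform \<epsilon> (spline n B c) u / energy_norm (spline n B c) = R"
  proof (cases "G = 0")
    case True
    then have g0: "g i = 0" if "i \<in> {1..n}" for i
      using that by (simp add: G_def sum_nonneg_eq_0_iff)
    \<comment> \<open>The form vanishes identically, so any nonzero test function will do; one exists as \<open>n \<ge> 2\<close>.\<close>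
    define c where "c = (\<lambda>i::nat. if i = 1 then 1 else 0 :: real)"
    have c: "c 0 = 0" "c n = 0" using assms(2) by (auto simp: c_def)
    have "(c 1 - c (1 - 1))\<^sup>2 \<le> D c"
      unfolding D_def by (rule member_le_sum) (use n in auto)
    then have "D c \<noteq> 0" by (simp add: c_def)
    moreover have "bform \<epsilon> (spline n B c) u = 0" unfolding b[OF c] using g0 by (intro sum.neutral) simp
    ultimately show ?thesis using c True by (intro exI[of _ c]) (simp add: R_def)
  next
    case False
    \<comment> \<open>Equality in the Cauchy-Schwarz inequality: the test function with increments \<open>g\<close>.\<close>
    define c where "c = (\<lambda>i. \<Sum>k = 1..i. g k)"
    have inc: "c i - c (i - 1) = g i" if "i \<in> {1..n}" for i
      using that by (cases i) (auto simp: c_def)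
    have "c n = (\<epsilon> + h * b\<^sub>1) / h * (\<Sum>i = 1..n. a i - a (i - 1)) - (\<Sum>i = 1..n. m i - mb)"
      unfolding c_def g_def by (simp only: sum_subtractf sum_distrib_left right_diff_distrib)
    then have c: "c 0 = 0" "c n = 0" using sum_a sum_m by (simp_all add: c_def)
    have D: "D c = G" unfolding D_def G_def using inc by (intro sum.cong) auto
    have "bform \<epsilon> (spline n B c) u = G"
      unfolding b[OF c] G_def power2_eq_square using inc by (intro sum.cong) auto
    also have "G = sqrt (D c) * sqrt G" using G0 by (simp add: D)
    finally have "bform \<epsilon> (spline n B c) u / energy_norm (spline n B c) = R"
      unfolding energy using scale[of c] D False by simp
    then show ?thesis using c D False by blast
  qed
  have "discrete_optimal_norm \<epsilon> n B u = ereal R"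
    unfolding discrete_optimal_norm_def
  proof (rule antisym)
    have T: "test_space n B = spline n B ` {c. c 0 = 0 \<and> c n = 0}"
      using mesh_bubble_axioms by (intro test_space_eq_splines) (simp add: hn)
    show "(SUP v\<in>test_space n B - {\<lambda>x. 0}. ereal (bform \<epsilon> v u / energy_norm v)) \<le> ereal R"
      unfolding T using upper by (intro SUP_least) auto
    obtain c where c: "c 0 = 0" "c n = 0" "D c \<noteq> 0"
      and R: "bform \<epsilon> (spline n B c) u / energy_norm (spline n B c) = R"
      using attained by blast
    have "spline n B c \<in> test_space n B - {\<lambda>x. 0}"
      unfolding T using c nonzero by auto
    then show "ereal R \<le> (SUP v\<in>test_space n B - {\<lambda>x. 0}. ereal (bform \<epsilon> v u / energy_norm v))"
      by (rule SUP_upper2) (simp add: R)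
  qed
  moreover have "R\<^sup>2 = h / (1 + b\<^sub>2) * G" using h b2 G0 by (simp add: R_def)
  moreover have "G = ((\<epsilon> + h * b\<^sub>1) / h)\<^sup>2 * (\<Sum>i = 1..n. (a i - a (i - 1))\<^sup>2) + (\<Sum>i = 1..n. (m i - mb)\<^sup>2)"
  proof -
    \<comment> \<open>The two parts of \<open>g\<close> are orthogonal.\<close>
    have cross: "(\<Sum>i = 1..n. (a i - a (i - 1)) * (m i - mb)) = 0"
    proof -
      have "(\<Sum>i = 1..n. (a i - a (i - 1)) * m i) = 0"
        using sum_increments_mult_averages[of a a n] a by (simp add: m_def)
      moreover have "(\<Sum>i = 1..n. (a i - a (i - 1)) * (m i - mb))
          = (\<Sum>i = 1..n. (a i - a (i - 1)) * m i) - (\<Sum>i = 1..n. a i - a (i - 1)) * mb"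
        unfolding sum_distrib_right sum_subtractf[symmetric] by (simp only: right_diff_distrib)
      ultimately show ?thesis using sum_a by simp
    qed
    have "G = (\<Sum>i = 1..n. ((\<epsilon> + h * b\<^sub>1) / h)\<^sup>2 * (a i - a (i - 1))\<^sup>2 + (m i - mb)\<^sup>2
        - 2 * ((\<epsilon> + h * b\<^sub>1) / h) * ((a i - a (i - 1)) * (m i - mb)))"
      unfolding G_def g_def by (intro sum.cong refl) (simp only: power2_diff power_mult_distrib mult.assoc)
    also have "\<dots> = ((\<epsilon> + h * b\<^sub>1) / h)\<^sup>2 * (\<Sum>i = 1..n. (a i - a (i - 1))\<^sup>2) + (\<Sum>i = 1..n. (m i - mb)\<^sup>2)
        - 2 * ((\<epsilon> + h * b\<^sub>1) / h) * (\<Sum>i = 1..n. (a i - a (i - 1)) * (m i - mb))"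
      by (simp only: sum_subtractf sum.distrib sum_distrib_left)
    finally show ?thesis by (simp only: cross mult_zero_right diff_zero)
  qed
  moreover have rescale: "h / q * ((k / h)\<^sup>2 * S + T) = k\<^sup>2 / q * (1 / h * S) + 1 / q * (h * T)"
    for k q S T :: real
    using h by (cases "q = 0") (simp_all add: power2_eq_square field_simps)
  moreover have "(energy_norm u)\<^sup>2 = 1 / h * (\<Sum>i = 1..n. (a i - a (i - 1))\<^sup>2)"
    using Z.energy_norm_spline[of 0 a] by (simp add: u_eq set_integrable_def)
  moreover have "(star_seminorm n u)\<^sup>2 = h * (\<Sum>i = 1..n. (m i - mb)\<^sup>2)"
    unfolding u_eq using a by (intro Z.star_seminorm_spline[OF _ _ m_def mb_def]) auto
  ultimately show "(discrete_optimal_norm \<epsilon> n B u)\<^sup>2 =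
      ereal ((\<epsilon> + h * b\<^sub>1)\<^sup>2 / (1 + b\<^sub>2) * (energy_norm u)\<^sup>2 + 1 / (1 + b\<^sub>2) * (star_seminorm n u)\<^sup>2)"
    using rescale by simp
qed

end
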